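(* Let $\tau:(0,\infty)\to\mathbb{R}$ be twice differentiable with $\tau'>0$, $\tau''<0$, $\tau(u)\to-\infty$ and $\int_1^u\tau(s)\,ds\to+\infty$ as $u\to0^+$. Let $\alpha,\lambda,\sigma,Y_0>0$ with $\lambda>\alpha$ satisfy $$Y_0=(\lambda-\alpha)\sigma,\qquad \sigma=\sqrt{\frac{\tau(\lambda)-\tau(\alpha)}{\lambda-\alpha}} .$$ Define $y(x,t)=\lambda x$ for $t\le 0$ and, for $t>0$, $$y(x,t)=\begin{cases}\lambda x, & x<-\sigma t,\\ -tY_0+\alpha x, & -\sigma t<x<0,\\ tY_0+\alpha x, & 0<x<\sigma t,\\ \lambda x, & \sigma t<x.\end{cases}$$ If $$\lim_{u\to\infty}\frac{\tau(u)}{u}=0,$$ then $y$ is a slic-solution of $y_{tt}=(\tau(y_x))_x$.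
   Context: Definition (slic-solution, i.e. singular limiting induced from continuum solution, in one space dimension). Let $y\in L^\infty_{loc}((-\infty,\infty);L^1_{loc}(\mathbb{R}))$ (as a function of $t$ with values in functions of $x$) satisfy, for some $\varepsilon>0$, the monotonicity condition $y(x_1,t)-y(x_2,t)>\varepsilon(x_1-x_2)$ for all $x_1,x_2,t\in\mathbb{R}$ with $x_1>x_2$ (values on null sets such as the jump location are irrelevant). For a mollifier $\phi\in C_c^\infty(\mathbb{R})$, $\phi\ge0$, $\operatorname{supp}\phi\subset B_1$ (the ball of radius 1), $\int\phi=1$, set $\phi_n(x)=n\phi(nx)$ and $$y^n(x,t)=\int_{\mathbb{R}}\phi_n(x-z)\,y(z,t)\,dz .$$ The function $y$ is called a slic-solution of $y_{tt}=(\tau(y_x))_x$ if for every symmetric mollifier $\phi$ (i.e. $\phi(-x)=\phi(x)$) and every $\psi\in C_c^\infty(\mathbb{R}\times\mathbb{R})$, $$\int_{\mathbb{R}}\int_{\mathbb{R}} y^n\psi_{tt}+\tau(y^n_x)\,\psi_x\,dx\,dt\to0\quad\text{as } n\to\infty .$$ *)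

theory Defs
  imports "HOL-Analysis.Analysis"
begin

primrec k_smooth :: "nat \<Rightarrow> ('a::euclidean_space \<Rightarrow> real) \<Rightarrow> bool" where
  "k_smooth 0 f \<longleftrightarrow> continuous_on UNIV f"
| "k_smooth (Suc k) f \<longleftrightarrow>
     (\<forall>x. f differentiable (at x)) \<and> (\<forall>v. k_smooth k (\<lambda>x. frechet_derivative f (at x) v))"

definition supp :: "('a::euclidean_space \<Rightarrow> real) \<Rightarrow> 'a set" where
  "supp f = closure {x. f x \<noteq> 0}"

definition test_function :: "('a::euclidean_space \<Rightarrow> real) \<Rightarrow> bool" where
  "test_function f \<longleftrightarrow> (\<forall>k. k_smooth k f) \<and> compact (supp f)"

definition mollifier :: "(real \<Rightarrow> real) \<Rightarrow> bool" where
  "mollifier \<phi> \<longleftrightarrow> test_function \<phi> \<and> (\<forall>x. 0 \<le> \<phi> x) \<and> supp \<phi> \<subseteq> ball 0 1 \<and> (LINT x|lebesgue. \<phi> x) = 1"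

definition symmetric_mollifier :: "(real \<Rightarrow> real) \<Rightarrow> bool" where
  "symmetric_mollifier \<phi> \<longleftrightarrow> mollifier \<phi> \<and> (\<forall>x. \<phi> (- x) = \<phi> x)"

text \<open>Functions of space and time are written \<open>y x t\<close>, space variable first.\<close>

definition mollify :: "(real \<Rightarrow> real) \<Rightarrow> (real \<Rightarrow> real \<Rightarrow> real) \<Rightarrow> nat \<Rightarrow> real \<Rightarrow> real \<Rightarrow> real" where
  "mollify \<phi> y n x t = (LINT z|lebesgue. real n * \<phi> (real n * (x - z)) * y z t)"

text \<open>Membership in \<open>L\<^sup>\<infinity>\<close>-loc in time with values in \<open>L\<^sup>1\<close>-loc in space. Since the spaces
  \<open>L\<^sup>1(K)\<close> are separable, Bochner measurability in time amounts to joint measurability.\<close>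

definition Linf_loc_L1_loc :: "(real \<Rightarrow> real \<Rightarrow> real) \<Rightarrow> bool" where
  "Linf_loc_L1_loc y \<longleftrightarrow>
     (\<lambda>(x, t). y x t) \<in> borel_measurable (lebesgue :: (real \<times> real) measure) \<and>
     (\<forall>K T. compact K \<and> compact T \<longrightarrow>
        (\<exists>C. AE t in lebesgue. t \<in> T \<longrightarrow>
           set_integrable lebesgue K (\<lambda>x. y x t) \<and> (LINT x:K|lebesgue. \<bar>y x t\<bar>) \<le> C))"

text \<open>The exceptional sets \<open>N\<close> make the condition insensitive to the values of \<open>y\<close> on null sets
  of space points, such as jump locations.\<close>

definition uniformly_increasing :: "real \<Rightarrow> (real \<Rightarrow> real \<Rightarrow> real) \<Rightarrow> bool" where
  "uniformly_increasing \<epsilon> y \<longleftrightarrow>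
     (\<forall>t. \<exists>N \<in> null_sets lebesgue. \<forall>x1 x2. x1 \<notin> N \<and> x2 \<notin> N \<and> x1 > x2 \<longrightarrow>
        y x1 t - y x2 t > \<epsilon> * (x1 - x2))"

definition weak_integrand ::
    "(real \<Rightarrow> real) \<Rightarrow> (real \<Rightarrow> real \<Rightarrow> real) \<Rightarrow> (real \<times> real \<Rightarrow> real) \<Rightarrow> real \<Rightarrow> real \<Rightarrow> real" where
  "weak_integrand \<tau> w \<psi> x t =
     w x t * deriv (\<lambda>s. deriv (\<lambda>r. \<psi> (x, r)) s) t
       + \<tau> (deriv (\<lambda>\<xi>. w \<xi> t) x) * deriv (\<lambda>\<xi>. \<psi> (\<xi>, t)) x"

text \<open>Because of the monotonicity condition, \<open>\<tau>\<close> is only evaluated at positive arguments (for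
  \<open>n \<ge> 1\<close>), so its values outside \<open>(0,\<infinity>)\<close> play no role. The Bochner integral of a non-integrable
  function is 0 by convention; integrability is therefore demanded explicitly, so that the
  double integrals are meaningful.\<close>

definition slic_solution :: "(real \<Rightarrow> real) \<Rightarrow> (real \<Rightarrow> real \<Rightarrow> real) \<Rightarrow> bool" where
  "slic_solution \<tau> y \<longleftrightarrow>
     Linf_loc_L1_loc y \<and>
     (\<exists>\<epsilon>>0. uniformly_increasing \<epsilon> y) \<and>
     (\<forall>\<phi> \<psi>. symmetric_mollifier \<phi> \<and> test_function \<psi> \<longrightarrow>
        (\<forall>n\<ge>1. integrable (lebesgue :: (real \<times> real) measure)
                  (\<lambda>(x, t). weak_integrand \<tau> (mollify \<phi> y n) \<psi> x t)) \<and>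
        (\<lambda>n. LINT t|lebesgue. LINT x|lebesgue. weak_integrand \<tau> (mollify \<phi> y n) \<psi> x t)
          \<longlonglongrightarrow> 0)"

end

theory Submission
  imports Defs
begin

text \<open>Mollification turns \<open>y\<close> into an explicit expression in the first and second primitives of the
  kernel. Off the three lines \<open>x = 0\<close>, \<open>x = \<plusminus>\<sigma> t\<close> both the mollified function and its slope are
  eventually equal to their pointwise limits, so dominated convergence applies to the weak integrand with
  \<open>\<tau>\<close> cut off at \<open>\<tau> lam\<close>, and its limit vanishes by the Rankine--Hugoniot condition at the fronts.
  The slope exceeds \<open>lam\<close> only for \<open>\<bar>x\<bar> < 1/n\<close>, where it is \<open>O(n)\<close>; hence the part cut off
  contributes at most \<open>O(1/n) * \<tau> (O(n))\<close>, which tends to 0 because \<open>\<tau> u / u\<close> does.\<close>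

subsection \<open>Test functions of space and time\<close>

text \<open>The obstacle is the jump of \<open>y\<close> across \<open>x = 0\<close>, of height
  \<open>2 * (lam - \<alpha>) * front \<sigma> t\<close>. Its smoothed slope grows like
  \<open>n\<close>, and the supremum over \<open>n\<close> of the stress there can be of the order
  of \<open>\<tau> (c / \<bar>x\<bar>)\<close>. Sublinear growth does not by itself make this
  integrable at \<open>x = 0\<close> (growth like \<open>u / ln u\<close> is an example), so in
  general the full integrand has no integrable majorant. The part above \<open>\<tau> lam\<close> is
  therefore estimated only after integration, by strip area times largest stress. The cap sits at
  \<open>\<tau> lam\<close> because \<open>lam\<close> bounds the slope outside the strip; from
  below the stress is controlled since the slope never falls under \<alpha>. In the limit the
  opening at \<open>x = 0\<close> carries no stress of its own: the whole fan between the fronts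
  counts as a state of slope \<alpha>, and \<open>(lam - \<alpha>) * \<sigma>\<^sup>2 = \<tau> lam -
  \<tau> \<alpha>\<close> balances it against the outer state.\<close>

lemma frechet_derivative_eq_0_on_open:
  fixes f :: "'a::euclidean_space \<Rightarrow> real"
  assumes "open S" "p \<in> S" "\<And>q. q \<in> S \<Longrightarrow> f q = 0"
  shows "frechet_derivative f (at p) v = 0"
proof -
  have "(f has_derivative (\<lambda>_. 0)) (at p)"
    by (rule has_derivative_transform_within_open[where f = "\<lambda>_. 0" and s = S]) (use assms in auto)
  then show ?thesis
    by (simp add: frechet_derivative_at[symmetric])
qed

text \<open>Bridges the Frechet derivatives of \<open>test_function\<close> and the one-variable
  \<open>deriv\<close> in \<open>weak_integrand\<close>: fixing the other coordinate composes
  \<open>f\<close> with an affine map whose derivative is \<open>h \<mapsto> (h, 0)\<close>.\<close>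

lemma has_real_derivative_fst:
  fixes f :: "real \<times> real \<Rightarrow> real"
  assumes "f differentiable (at (x, t))"
  shows "((\<lambda>\<xi>. f (\<xi>, t)) has_real_derivative frechet_derivative f (at (x, t)) (1, 0)) (at x)"
proof -
  let ?D = "frechet_derivative f (at (x, t))"
  have D: "(f has_derivative ?D) (at (x, t))"
    using assms frechet_derivative_works by blast
  have "((\<lambda>\<xi>. (\<xi>, t)) has_derivative (\<lambda>h. (h, 0))) (at x)"
    by (intro has_derivative_Pair has_derivative_ident has_derivative_const)
  from has_derivative_compose[OF this D]
  have "((\<lambda>\<xi>. f (\<xi>, t)) has_derivative (\<lambda>h. ?D (h, 0))) (at x)" .
  moreover have "(\<lambda>h. ?D (h, 0)) = (*) (?D (1, 0))"
  proof
    show "?D (h, 0) = ?D (1, 0) * h" for h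
      using linear_scale[OF has_derivative_linear[OF D], of h "(1, 0)"] by (simp add: mult.commute)
  qed
  ultimately show ?thesis
    unfolding has_field_derivative_def by metis
qed

lemma has_real_derivative_snd:
  fixes f :: "real \<times> real \<Rightarrow> real"
  assumes "f differentiable (at (x, t))"
  shows "((\<lambda>s. f (x, s)) has_real_derivative frechet_derivative f (at (x, t)) (0, 1)) (at t)"
proof -
  let ?D = "frechet_derivative f (at (x, t))"
  have D: "(f has_derivative ?D) (at (x, t))"
    using assms frechet_derivative_works by blast
  have "((\<lambda>s. (x, s)) has_derivative (\<lambda>h. (0, h))) (at t)"
    by (intro has_derivative_Pair has_derivative_ident has_derivative_const)
  from has_derivative_compose[OF this D]
  have "((\<lambda>s. f (x, s)) has_derivative (\<lambda>h. ?D (0, h))) (at t)" .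
  moreover have "(\<lambda>h. ?D (0, h)) = (*) (?D (0, 1))"
  proof
    show "?D (0, h) = ?D (0, 1) * h" for h
      using linear_scale[OF has_derivative_linear[OF D], of h "(0, 1)"] by (simp add: mult.commute)
  qed
  ultimately show ?thesis
    unfolding has_field_derivative_def by metis
qed

text \<open>What the weak formulation and its integrations by parts use of a test function. The
  square of half-width \<open>R\<close> stands in for the compact support, and
  \<open>\<psi>t\<close> links \<open>\<psi>\<close> to \<open>\<psi>tt\<close>.\<close>

locale space_time_bump =
  fixes \<psi> \<psi>x \<psi>t \<psi>tt :: "real \<times> real \<Rightarrow> real" and R :: real
  assumes R_pos: "R > 0"
    and cont: "continuous_on UNIV \<psi>" "continuous_on UNIV \<psi>x" "continuous_on UNIV \<psi>t" "continuous_on UNIV \<psi>tt"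
    and deriv_x: "((\<lambda>\<xi>. \<psi> (\<xi>, t)) has_real_derivative \<psi>x (x, t)) (at x)"
    and deriv_t: "((\<lambda>s. \<psi> (x, s)) has_real_derivative \<psi>t (x, t)) (at t)"
    and deriv_tt: "((\<lambda>s. \<psi>t (x, s)) has_real_derivative \<psi>tt (x, t)) (at t)"
    and vanish: "R \<le> \<bar>x\<bar> \<or> R \<le> \<bar>t\<bar> \<Longrightarrow> \<psi> (x, t) = 0 \<and> \<psi>x (x, t) = 0 \<and> \<psi>t (x, t) = 0 \<and> \<psi>tt (x, t) = 0"

lemma test_function_imp_space_time_bump:
  assumes "test_function \<psi>"
  obtains \<psi>x \<psi>t \<psi>tt R where "space_time_bump \<psi> \<psi>x \<psi>t \<psi>tt R"
proof -
  have sm: "k_smooth k \<psi>" and cpt: "compact (supp \<psi>)" for k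
    using assms by (auto simp: test_function_def)
  define D where "D v p = frechet_derivative \<psi> (at p) v" for v p
  define \<psi>tt where "\<psi>tt p = frechet_derivative (D (0, 1)) (at p) (0, 1)" for p
  have sD: "k_smooth k (D v)" for k v
    using sm[of "Suc k"] by (simp add: D_def[abs_def] del: split_paired_All)
  have diff: "\<psi> differentiable (at p)" "D v differentiable (at p)" for p v
    using sm[of "Suc 0"] sD[of "Suc 0" v] by (simp_all del: split_paired_All)
  obtain B where B: "\<And>p. p \<in> supp \<psi> \<Longrightarrow> norm p \<le> B"
    using compact_imp_bounded[OF cpt] unfolding bounded_iff by blast
  \<comment> \<open>The absolute value covers an empty support, where \<open>B\<close> may be
    negative; adding 1 makes the separation strict and the half-width positive.\<close>
  have out: "p \<in> - supp \<psi>" if "\<bar>B\<bar> + 1 \<le> \<bar>fst p\<bar> \<or> \<bar>B\<bar> + 1 \<le> \<bar>snd p\<bar>" for p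
  proof -
    have "\<bar>fst p\<bar> \<le> norm p" "\<bar>snd p\<bar> \<le> norm p"
      using norm_fst_le[of "fst p" "snd p"] norm_snd_le[of "snd p" "fst p"] by simp_all
    with that B[of p] show ?thesis
      by (intro ComplI) linarith
  qed
  \<comment> \<open>A zero of \<open>\<psi>\<close> alone says nothing about its derivatives;
    openness of the complement of the support lets them inherit the vanishing, twice in a row for
    \<open>\<psi>tt\<close>.\<close>
  have op: "open (- supp \<psi>)"
    by (simp add: supp_def open_Compl)
  have z: "\<psi> p = 0" if "p \<in> - supp \<psi>" for p
    using that closure_subset[of "{x. \<psi> x \<noteq> 0}"] by (auto simp: supp_def)
  have zD: "D v p = 0" if "p \<in> - supp \<psi>" for p v
    unfolding D_def by (rule frechet_derivative_eq_0_on_open[OF op that z])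
  have ztt: "\<psi>tt p = 0" if "p \<in> - supp \<psi>" for p
    unfolding \<psi>tt_def by (rule frechet_derivative_eq_0_on_open[OF op that zD])
  have "space_time_bump \<psi> (D (1, 0)) (D (0, 1)) \<psi>tt (\<bar>B\<bar> + 1)"
  proof
    show "continuous_on UNIV \<psi>" "continuous_on UNIV (D (1, 0))" "continuous_on UNIV (D (0, 1))"
      using sm[of 0] sD[of 0] by auto
    show "continuous_on UNIV \<psi>tt"
      using sD[of "Suc 0" "(0, 1)"] by (simp add: \<psi>tt_def[abs_def])
    fix x t :: real
    show "((\<lambda>\<xi>. \<psi> (\<xi>, t)) has_real_derivative D (1, 0) (x, t)) (at x)"
      using has_real_derivative_fst[OF diff(1)] by (simp add: D_def)
    show "((\<lambda>s. \<psi> (x, s)) has_real_derivative D (0, 1) (x, t)) (at t)"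
      using has_real_derivative_snd[OF diff(1)] by (simp add: D_def)
    show "((\<lambda>s. D (0, 1) (x, s)) has_real_derivative \<psi>tt (x, t)) (at t)"
      using has_real_derivative_snd[OF diff(2)] by (simp add: \<psi>tt_def)
    assume "\<bar>B\<bar> + 1 \<le> \<bar>x\<bar> \<or> \<bar>B\<bar> + 1 \<le> \<bar>t\<bar>"
    then have "(x, t) \<in> - supp \<psi>"
      by (intro out) simp
    then show "\<psi> (x, t) = 0 \<and> D (1, 0) (x, t) = 0 \<and> D (0, 1) (x, t) = 0 \<and> \<psi>tt (x, t) = 0"
      by (simp add: z zD ztt)
  qed simp
  then show thesis ..
qed

subsection \<open>Primitives of a mollifier\<close>

lemma continuous_imp_antiderivative:
  fixes f :: "real \<Rightarrow> real"
  assumes "continuous_on UNIV f"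
  obtains F where "\<And>x. (F has_real_derivative f x) (at x)" "F c = 0"
proof -
  have "\<exists>F. \<forall>x::real. -\<infinity> < ereal x \<longrightarrow> ereal x < \<infinity> \<longrightarrow> (F has_vector_derivative f x) (at x)"
    using assms by (intro einterval_antiderivative) (auto simp: continuous_on_eq_continuous_at)
  then obtain F where F: "\<And>x. (F has_real_derivative f x) (at x)"
    by (auto simp: has_real_derivative_iff_has_vector_derivative)
  show thesis
    by (rule that[of "\<lambda>x. F x - F c"]) (auto intro!: derivative_eq_intros F)
qed

text \<open>The additive constant 0 in \<open>\<Psi> s = s\<close> for \<open>s \<ge> 1\<close> is where the symmetry of the mollifier enters.\<close>

locale mollifier_primitives =
  fixes \<phi> \<Phi> \<Psi> :: "real \<Rightarrow> real"
  assumes \<phi>_cont: "continuous_on UNIV \<phi>"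
    and \<phi>_nonneg: "0 \<le> \<phi> s"
    and \<phi>_vanish: "1 \<le> \<bar>s\<bar> \<Longrightarrow> \<phi> s = 0"
    and \<Phi>_deriv: "(\<Phi> has_real_derivative \<phi> s) (at s)"
    and \<Psi>_deriv: "(\<Psi> has_real_derivative \<Phi> s) (at s)"
    and left: "s \<le> -1 \<Longrightarrow> \<Phi> s = 0 \<and> \<Psi> s = 0"
    and right: "1 \<le> s \<Longrightarrow> \<Phi> s = 1 \<and> \<Psi> s = s"

text \<open>Both primitives are normalised at -1, hence vanish to the left of the kernel. Unit mass
  gives \<open>\<Phi> 1 = 1\<close>. Evenness of \<open>\<phi>\<close> makes
  \<open>\<Phi> s + \<Phi> (- s)\<close> constant, and integrating this once more fixes the constant
  in \<open>\<Psi>\<close> on the right.\<close>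

lemma symmetric_mollifier_imp_primitives:
  assumes "symmetric_mollifier \<phi>"
  obtains \<Phi> \<Psi> where "mollifier_primitives \<phi> \<Phi> \<Psi>"
proof -
  have cont: "continuous_on UNIV \<phi>" and nonneg: "\<And>s. 0 \<le> \<phi> s" and supp: "supp \<phi> \<subseteq> ball 0 1"
    and int: "(LINT x|lebesgue. \<phi> x) = 1" and sym: "\<And>s. \<phi> (- s) = \<phi> s"
    using assms by (auto simp: symmetric_mollifier_def mollifier_def test_function_def elim: allE[of _ 0])
  have vanish: "\<phi> s = 0" if "1 \<le> \<bar>s\<bar>" for s
    using that supp closure_subset[of "{x. \<phi> x \<noteq> 0}"] by (force simp: supp_def)
  obtain \<Phi> where \<Phi>: "\<And>s. (\<Phi> has_real_derivative \<phi> s) (at s)" "\<Phi> (-1) = 0"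
    using continuous_imp_antiderivative[OF cont] by blast
  have "continuous_on UNIV \<Phi>"
    using \<Phi>(1) DERIV_continuous continuous_at_imp_continuous_on by blast
  then obtain \<Psi> where \<Psi>: "\<And>s. (\<Psi> has_real_derivative \<Phi> s) (at s)" "\<Psi> (-1) = 0"
    using continuous_imp_antiderivative by blast
  have mvt: "F b = F a" if "a \<le> b" "\<And>s. (F has_real_derivative F' s) (at s)" "\<And>s. a < s \<Longrightarrow> s < b \<Longrightarrow> F' s = 0"
    for F F' :: "real \<Rightarrow> real" and a b
  proof (cases "a = b")
    case False
    then show ?thesis
      using MVT2[of a b F F'] that by force
  qed simp
  have l\<Phi>: "\<Phi> s = 0" if "s \<le> -1" for s
    using mvt[of s "-1" \<Phi> \<phi>] that \<Phi> vanish by simp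
  have "(LINT x|lborel. \<phi> x) = \<Phi> 1 - \<Phi> (-1)"
  proof -
    have "(LINT x|lborel. \<phi> x * indicator {-1..1} x) = \<Phi> 1 - \<Phi> (-1)"
      using cont by (intro integral_FTC_Icc_real \<Phi>) (auto simp: continuous_on_eq_continuous_at)
    moreover have "\<phi> x * indicator {-1..1} x = \<phi> x" for x
      using vanish[of x] by (cases "1 \<le> \<bar>x\<bar>") (auto simp: indicator_def abs_le_iff)
    ultimately show ?thesis by simp
  qed
  then have \<Phi>1: "\<Phi> 1 = 1"
    using int \<Phi>(2) cont by (simp add: integral_completion borel_measurable_continuous_onI)
  have r\<Phi>: "\<Phi> s = 1" if "1 \<le> s" for s
    using mvt[of 1 s \<Phi> \<phi>] that \<Phi> \<Phi>1 vanish by simp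
  have l\<Psi>: "\<Psi> s = 0" if "s \<le> -1" for s
    using mvt[of s "-1" \<Psi> \<Phi>] that \<Psi> l\<Phi> by simp
  have d\<Phi>: "((\<lambda>s. \<Phi> s + \<Phi> (- s)) has_real_derivative 0) (at s)" for s
    by (rule derivative_eq_intros \<Phi> DERIV_chain2[OF \<Phi>(1)] refl | simp add: sym)+
  have sym\<Phi>: "\<Phi> s + \<Phi> (- s) = 1" for s
    using DERIV_isconst_all[of "\<lambda>s. \<Phi> s + \<Phi> (- s)" s 1] d\<Phi> \<Phi> \<Phi>1 by simp
  \<comment> \<open>The derivative is \<open>\<Phi> s + \<Phi> (- s) - 1\<close>, and the function,
    being odd, is 0 at 0.\<close>
  have d\<Psi>: "((\<lambda>s. \<Psi> s - \<Psi> (- s) - s) has_real_derivative 0) (at s)" for s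
    by (rule derivative_eq_intros \<Psi> DERIV_chain2[OF \<Psi>(1)] refl | use sym\<Phi>[of s] in simp)+
  have sym\<Psi>: "\<Psi> s - \<Psi> (- s) = s" for s
    using DERIV_isconst_all[of "\<lambda>s. \<Psi> s - \<Psi> (- s) - s" s 0] d\<Psi> by simp
  have r\<Psi>: "\<Psi> s = s" if "1 \<le> s" for s
    using sym\<Psi>[of s] l\<Psi>[of "- s"] that by simp
  have "mollifier_primitives \<phi> \<Phi> \<Psi>"
    by unfold_locales (use cont nonneg vanish \<Phi> \<Psi> l\<Phi> l\<Psi> r\<Phi> r\<Psi> in auto)
  then show thesis ..
qed

context mollifier_primitives
begin

lemma \<Phi>_mono: "r \<le> s \<Longrightarrow> \<Phi> r \<le> \<Phi> s"
  using \<Phi>_deriv \<phi>_nonneg by (meson DERIV_nonneg_imp_nondecreasing)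

lemma \<Phi>_bounds: "0 \<le> \<Phi> s" "\<Phi> s \<le> 1"
  using \<Phi>_mono[of "min s (-1)" s] \<Phi>_mono[of s "max s 1"] left[of "min s (-1)"] right[of "max s 1"]
  by auto

lemma \<Psi>_Lipschitz:
  assumes "r \<le> s"
  shows "0 \<le> \<Psi> s - \<Psi> r" "\<Psi> s - \<Psi> r \<le> s - r"
proof -
  have "\<Psi> r \<le> \<Psi> s"
    by (rule DERIV_nonneg_imp_nondecreasing[OF assms]) (use \<Psi>_deriv \<Phi>_bounds in blast)
  then show "0 \<le> \<Psi> s - \<Psi> r" by simp
  have "((\<lambda>s. s - \<Psi> s) has_real_derivative 1 - \<Phi> s) (at s)" for s
    by (intro DERIV_diff DERIV_ident \<Psi>_deriv)
  moreover have "0 \<le> 1 - \<Phi> s" for s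
    using \<Phi>_bounds by simp
  ultimately have "r - \<Psi> r \<le> s - \<Psi> s"
    by (intro DERIV_nonneg_imp_nondecreasing[OF assms, of "\<lambda>s. s - \<Psi> s"]) blast
  then show "\<Psi> s - \<Psi> r \<le> s - r" by simp
qed

lemma continuous_primitives: "continuous_on UNIV \<Phi>" "continuous_on UNIV \<Psi>"
  by (rule DERIV_continuous_on, rule \<Phi>_deriv, rule DERIV_continuous_on, rule \<Psi>_deriv)

lemma \<phi>_bounded: obtains P where "P > 0" "\<And>s. \<phi> s \<le> P"
proof -
  obtain P where P: "\<And>s. s \<in> {-1..1} \<Longrightarrow> norm (\<phi> s) \<le> P"
    using compact_imp_bounded[OF compact_continuous_image[OF continuous_on_subset[OF \<phi>_cont] compact_Icc]]
    unfolding bounded_iff by (metis imageI subset_UNIV)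
  show thesis
  proof (rule that[of "\<bar>P\<bar> + 1"])
    show "\<phi> s \<le> \<bar>P\<bar> + 1" for s
      using P[of s] \<phi>_vanish[of s] by (cases "s \<in> {-1..1}") auto
  qed simp
qed

text \<open>Affine functions on half lines are the building blocks of the profile, so this one
  integral yields its whole mollification.\<close>

lemma has_bochner_integral_half_line:
  assumes "n > 0"
  shows "has_bochner_integral lborel (\<lambda>z. n * \<phi> (n * (x - z)) * (indicator {c..} z * (p + q * z)))
           (\<Phi> (n * (x - c)) * (p + q * c) + q * \<Psi> (n * (x - c)) / n)"
proof -
  \<comment> \<open>Beyond \<open>x + 1 / n\<close> the kernel is zero, so the half line may be cut
    there; the maximum keeps the interval nonempty.\<close>
  define B where "B = max c (x + 1 / n)"
  \<comment> \<open>Integration by parts: differentiating \<open>p + q * z\<close> in the first term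
    leaves \<open>- q * \<Phi> (n * (x - z))\<close>, which the second term cancels. Both terms
    vanish at \<open>B\<close>.\<close>
  define F where "F z = - \<Phi> (n * (x - z)) * (p + q * z) - q * \<Psi> (n * (x - z)) / n" for z
  have B: "n * (x - z) \<le> -1" if "z \<ge> B" for z
  proof -
    have "n * (x - z) \<le> n * (- (1 / n))"
      using that assms by (intro mult_left_mono) (auto simp: B_def)
    then show ?thesis using assms by simp
  qed
  have "(F has_real_derivative n * \<phi> (n * (x - z)) * (p + q * z)) (at z)" for z
    unfolding F_def
    by (rule derivative_eq_intros DERIV_chain2[OF \<Phi>_deriv] DERIV_chain2[OF \<Psi>_deriv] refl | use assms in \<open>simp add: field_simps\<close>)+
  moreover have "isCont (\<lambda>z. n * \<phi> (n * (x - z)) * (p + q * z)) z" for z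
  proof -
    have "continuous_on UNIV (\<lambda>z. n * \<phi> (n * (x - z)) * (p + q * z))"
      by (intro continuous_on_mult continuous_on_compose2[OF \<phi>_cont] continuous_intros) auto
    then show ?thesis
      by (simp add: continuous_on_eq_continuous_at)
  qed
  ultimately have "has_bochner_integral lborel
     (\<lambda>z. n * \<phi> (n * (x - z)) * (p + q * z) * indicator {c..B} z) (F B - F c)"
    by (intro has_bochner_integral_FTC_Icc_real) (auto simp: B_def)
  moreover have "n * \<phi> (n * (x - z)) * (p + q * z) * indicator {c..B} z
      = n * \<phi> (n * (x - z)) * (indicator {c..} z * (p + q * z))" for z
    using B[of z] \<phi>_vanish[of "n * (x - z)"] by (auto simp: indicator_def)
  moreover have "F B = 0"
    using left[OF B[of B]] by (simp add: F_def)
  ultimately show ?thesis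
    by (simp add: F_def add.commute)
qed

end

subsection \<open>The shock profile and its mollification\<close>

text \<open>Clipping \<open>t\<close> at 0 collapses the fan at nonpositive times, so that one
  formula for the profile serves all \<open>t\<close>.\<close>

definition front :: "real \<Rightarrow> real \<Rightarrow> real" where
  "front \<sigma> t = \<sigma> * max 0 t"

text \<open>The solution, with its values on the lines \<open>x = 0\<close> and \<open>x = \<plusminus>\<sigma> t\<close> fixed by right
  continuity, as a combination of ramps and a step, all of which mollify to primitives of the kernel.\<close>

definition profile :: "real \<Rightarrow> real \<Rightarrow> real \<Rightarrow> real \<Rightarrow> real \<Rightarrow> real" where
  "profile \<alpha> lam \<sigma> x t = lam * x + (lam - \<alpha>) * (2 * front \<sigma> t * indicator {0..} x
     + (max 0 (x - front \<sigma> t) - max 0 (x + front \<sigma> t)))"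

lemma front_nonneg: "\<sigma> > 0 \<Longrightarrow> 0 \<le> front \<sigma> t"
  by (simp add: front_def)

lemma continuous_front [continuous_intros]:
  "continuous_on A f \<Longrightarrow> continuous_on A (\<lambda>x. front \<sigma> (f x))"
  unfolding front_def by (intro continuous_intros)

text \<open>Time enters this form through a single maximum, which makes the profile explicit as a
  function of \<open>t\<close> for fixed \<open>x\<close>.\<close>

lemma profile_eq_sgn:
  assumes "\<sigma> > 0" "x \<noteq> 0"
  shows "profile \<alpha> lam \<sigma> x t = \<alpha> * x + (lam - \<alpha>) * (sgn x * max \<bar>x\<bar> (front \<sigma> t))"
proof -
  have "x + (2 * front \<sigma> t * indicator {0..} x + (max 0 (x - front \<sigma> t) - max 0 (x + front \<sigma> t)))
      = sgn x * max \<bar>x\<bar> (front \<sigma> t)"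
    using assms front_nonneg[of \<sigma> t] by (auto simp: max_def indicator_def sgn_if)
  then show ?thesis
    by (simp add: profile_def flip: \<open>_ = sgn x * _\<close>) (simp add: algebra_simps)
qed

text \<open>After removal of \<open>\<alpha> * x\<close> there remains
  \<open>(lam - \<alpha>) * v x\<close>, where \<open>v\<close> is the identity outside the fronts,
  constant on either side of 0 between them, and jumps upwards at 0.\<close>

lemma profile_increasing:
  assumes "\<sigma> > 0" "\<alpha> \<le> lam" "r \<le> s"
  shows "\<alpha> * (s - r) \<le> profile \<alpha> lam \<sigma> s t - profile \<alpha> lam \<sigma> r t"
proof -
  define v where "v x = x + (2 * front \<sigma> t * indicator {0..} x
     + (max 0 (x - front \<sigma> t) - max 0 (x + front \<sigma> t)))" for x
  have "v r \<le> v s"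
    using assms front_nonneg[of \<sigma> t] by (auto simp: v_def max_def indicator_def)
  then have "(lam - \<alpha>) * v r \<le> (lam - \<alpha>) * v s"
    using assms by (intro mult_left_mono) auto
  moreover have "profile \<alpha> lam \<sigma> x t = \<alpha> * x + (lam - \<alpha>) * v x" for x
    by (simp add: profile_def v_def algebra_simps)
  ultimately show ?thesis
    by (simp add: right_diff_distrib)
qed

text \<open>The 4 adds \<open>2 * front \<sigma> t\<close> for the step and the same for the ramps,
  ignoring their opposite signs; \<open>smoothed_bound\<close> obtains the same majorant for every
  \<open>n\<close>.\<close>

lemma profile_bound:
  assumes "\<sigma> > 0" "\<alpha> \<le> lam" "0 \<le> \<alpha>"
  shows "\<bar>profile \<alpha> lam \<sigma> x t\<bar> \<le> lam * \<bar>x\<bar> + (lam - \<alpha>) * (4 * front \<sigma> t)"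
proof -
  define v where "v = 2 * front \<sigma> t * indicator {0..} x + (max 0 (x - front \<sigma> t) - max 0 (x + front \<sigma> t))"
  have "\<bar>v\<bar> \<le> 4 * front \<sigma> t"
    using front_nonneg[OF assms(1), of t] by (auto simp: v_def max_def indicator_def)
  then have "\<bar>(lam - \<alpha>) * v\<bar> \<le> (lam - \<alpha>) * (4 * front \<sigma> t)"
    using assms by (simp add: abs_mult mult_left_mono)
  moreover have "\<bar>lam * x\<bar> = lam * \<bar>x\<bar>"
    using assms by (simp add: abs_mult)
  ultimately show ?thesis
    unfolding profile_def v_def[symmetric] by linarith
qed

lemma borel_measurable_profile [measurable]:
  "(\<lambda>p. profile \<alpha> lam \<sigma> (fst p) (snd p)) \<in> borel_measurable borel"
proof -
  have [measurable]: "(\<lambda>p. front \<sigma> (snd p)) \<in> borel_measurable (borel :: (real \<times> real) measure)"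
    by (intro borel_measurable_continuous_onI continuous_intros)
  have [measurable]: "(\<lambda>p. fst p) \<in> borel_measurable (borel :: (real \<times> real) measure)"
    by (intro borel_measurable_continuous_onI continuous_intros)
  show ?thesis
    unfolding profile_def by measurable
qed

lemma borel_measurable_profile_slice [measurable]:
  "(\<lambda>x. profile \<alpha> lam \<sigma> x t) \<in> borel_measurable borel"
  unfolding profile_def by measurable

text \<open>Smoothing at scale \<open>1 / n\<close> turns the step into
  \<open>\<Phi> (n * x)\<close> and the ramp starting at \<open>c\<close> into
  \<open>\<Psi> (n * (x - c)) / n\<close>; the linear term is unchanged because an even kernel has
  vanishing first moment.\<close>

definition smoothed :: "(real \<Rightarrow> real) \<Rightarrow> (real \<Rightarrow> real) \<Rightarrow> real \<Rightarrow> real \<Rightarrow> real \<Rightarrow> real \<Rightarrow> real \<times> real \<Rightarrow> real" where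
  "smoothed \<Phi> \<Psi> \<alpha> lam \<sigma> n = (\<lambda>(x, t). lam * x + (lam - \<alpha>) * (2 * front \<sigma> t * \<Phi> (n * x)
     + (\<Psi> (n * (x - front \<sigma> t)) / n - \<Psi> (n * (x + front \<sigma> t)) / n)))"

definition smoothed_x :: "(real \<Rightarrow> real) \<Rightarrow> (real \<Rightarrow> real) \<Rightarrow> real \<Rightarrow> real \<Rightarrow> real \<Rightarrow> real \<Rightarrow> real \<times> real \<Rightarrow> real" where
  "smoothed_x \<phi> \<Phi> \<alpha> lam \<sigma> n = (\<lambda>(x, t). lam + (lam - \<alpha>) * (2 * front \<sigma> t * (n * \<phi> (n * x))
     + (\<Phi> (n * (x - front \<sigma> t)) - \<Phi> (n * (x + front \<sigma> t)))))"

section \<open>Closed form of the mollified profile, its slope, and bounds uniform in the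
  scale\<close>

context mollifier_primitives
begin

lemma mollify_profile:
  assumes "n \<ge> 1"
  shows "mollify \<phi> (profile \<alpha> lam \<sigma>) n x t = smoothed \<Phi> \<Psi> \<alpha> lam \<sigma> (real n) (x, t)"
proof -
  let ?a = "front \<sigma> t" and ?k = "\<lambda>z. real n * \<phi> (real n * (x - z))"
  have n: "real n > 0" using assms by simp
  note I = has_bochner_integral_half_line[OF n, of x]
  \<comment> \<open>The identity is integrated from \<open>x - 1 / n\<close>, to the left of which
    the kernel is zero; \<open>\<Phi> 1 = \<Psi> 1 = 1\<close> then gives
    \<open>(x - 1 / n) + 1 / n\<close>.\<close>
  have id: "has_bochner_integral lborel (\<lambda>z. ?k z * z) x"
  proof -
    have e: "?k z * (indicator {x - 1 / n..} z * (0 + 1 * z)) = ?k z * z" for z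
    proof (cases "x - 1 / n \<le> z")
      case False
      then have "z + 1 / n \<le> x" by simp
      then have "real n * (1 / n) \<le> real n * (x - z)"
        using n by (intro mult_left_mono) simp_all
      then have "1 \<le> \<bar>real n * (x - z)\<bar>"
        using n by simp
      then show ?thesis by (simp add: \<phi>_vanish)
    qed simp
    have "real n * (x - (x - 1 / n)) = 1"
      using n by simp
    with I[of "x - 1 / n" 0 1] show ?thesis
      unfolding e using right[of 1] by simp
  qed
  have step: "has_bochner_integral lborel (\<lambda>z. ?k z * indicator {0..} z) (\<Phi> (real n * x))"
    using I[of 0 1 0] by simp
  have ramp: "has_bochner_integral lborel (\<lambda>z. ?k z * max 0 (z - c)) (\<Psi> (real n * (x - c)) / n)" for c
  proof -
    have "indicator {c..} z * (- c + 1 * z) = max 0 (z - c)" for z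
      by (auto simp: indicator_def)
    then show ?thesis
      using I[of c "- c" 1] by simp
  qed
  have "has_bochner_integral lborel (\<lambda>z. lam * (?k z * z) + (lam - \<alpha>) * (2 * ?a * (?k z * indicator {0..} z)
        + (?k z * max 0 (z - ?a) - ?k z * max 0 (z - (- ?a)))))
      (lam * x + (lam - \<alpha>) * (2 * ?a * \<Phi> (real n * x)
        + (\<Psi> (real n * (x - ?a)) / n - \<Psi> (real n * (x - (- ?a))) / n)))"
    by (intro has_bochner_integral_add has_bochner_integral_diff has_bochner_integral_mult_right id step ramp)
  moreover have "lam * (?k z * z) + (lam - \<alpha>) * (2 * ?a * (?k z * indicator {0..} z)
        + (?k z * max 0 (z - ?a) - ?k z * max 0 (z - (- ?a)))) = ?k z * profile \<alpha> lam \<sigma> z t" for z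
    by (simp add: profile_def algebra_simps)
  ultimately have "has_bochner_integral lborel (\<lambda>z. ?k z * profile \<alpha> lam \<sigma> z t) (smoothed \<Phi> \<Psi> \<alpha> lam \<sigma> (real n) (x, t))"
    by (simp add: smoothed_def)
  moreover have "mollify \<phi> (profile \<alpha> lam \<sigma>) n x t = (LINT z|lborel. ?k z * profile \<alpha> lam \<sigma> z t)"
    unfolding mollify_def
    by (intro integral_completion) (use calculation borel_measurable_has_bochner_integral in blast)
  ultimately show ?thesis
    by (simp add: has_bochner_integral_integral_eq)
qed

text \<open>Needed because \<open>y\<close> is prescribed only off the three lines. Measurability is
  assumed for \<open>w\<close> alone and passes to \<open>y\<close> by completeness of
  \<open>lebesgue\<close>.\<close>

lemma mollify_cong_AE:
  assumes "AE z in lebesgue. y z t = w z t"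
    and [measurable]: "(\<lambda>z. w z t) \<in> borel_measurable borel"
  shows "mollify \<phi> y n x t = mollify \<phi> w n x t"
proof -
  have k: "(\<lambda>z. real n * \<phi> (real n * (x - z))) \<in> borel_measurable borel"
    by (intro borel_measurable_continuous_onI continuous_on_mult continuous_on_compose2[OF \<phi>_cont] continuous_intros) auto
  then have "(\<lambda>z. real n * \<phi> (real n * (x - z)) * w z t) \<in> borel_measurable borel"
    by measurable
  then have m: "(\<lambda>z. real n * \<phi> (real n * (x - z)) * w z t) \<in> borel_measurable lebesgue"
    by (intro measurable_completion) simp
  have ae: "AE z in lebesgue. real n * \<phi> (real n * (x - z)) * w z t = real n * \<phi> (real n * (x - z)) * y z t"
    using assms(1) by eventually_elim simp
  then have "AE z in lebesgue. real n * \<phi> (real n * (x - z)) * y z t = real n * \<phi> (real n * (x - z)) * w z t"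
    by (rule AE_symmetric)
  show ?thesis
    unfolding mollify_def
    by (intro integral_cong_AE borel_measurable_AE[OF m ae] m) fact
qed

lemma smoothed_deriv:
  assumes "n > 0"
  shows "((\<lambda>\<xi>. smoothed \<Phi> \<Psi> \<alpha> lam \<sigma> n (\<xi>, t)) has_real_derivative smoothed_x \<phi> \<Phi> \<alpha> lam \<sigma> n (x, t)) (at x)"
proof -
  have 1: "((\<lambda>\<xi>. \<Phi> (n * \<xi>)) has_real_derivative \<phi> (n * x) * n) (at x)"
    by (rule DERIV_chain2[OF \<Phi>_deriv]) (auto intro!: derivative_eq_intros)
  have 2: "((\<lambda>\<xi>. \<Psi> (n * (\<xi> + c))) has_real_derivative \<Phi> (n * (x + c)) * n) (at x)" for c
    by (rule DERIV_chain2[OF \<Psi>_deriv]) (auto intro!: derivative_eq_intros)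
  have "((\<lambda>\<xi>. lam * \<xi> + (lam - \<alpha>) * (2 * front \<sigma> t * \<Phi> (n * \<xi>)
      + (\<Psi> (n * (\<xi> + - front \<sigma> t)) / n - \<Psi> (n * (\<xi> + front \<sigma> t)) / n))) has_real_derivative
      (lam * 1 + (lam - \<alpha>) * (2 * front \<sigma> t * (\<phi> (n * x) * n)
      + (\<Phi> (n * (x + - front \<sigma> t)) * n / n - \<Phi> (n * (x + front \<sigma> t)) * n / n)))) (at x)"
    by (intro DERIV_add DERIV_diff DERIV_cmult DERIV_cdivide DERIV_ident 1 2)
  then show ?thesis
    using assms by (simp add: smoothed_def smoothed_x_def mult.commute)
qed

lemma continuous_smoothed: "continuous_on UNIV (smoothed \<Phi> \<Psi> \<alpha> lam \<sigma> n)"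
  unfolding smoothed_def case_prod_beta divide_inverse
  by (intro continuous_intros continuous_on_compose2[OF continuous_primitives(1)]
      continuous_on_compose2[OF continuous_primitives(2)]) auto

lemma continuous_smoothed_x: "continuous_on UNIV (smoothed_x \<phi> \<Phi> \<alpha> lam \<sigma> n)"
  unfolding smoothed_x_def case_prod_beta
  by (intro continuous_intros continuous_on_compose2[OF continuous_primitives(1)]
      continuous_on_compose2[OF \<phi>_cont]) auto

text \<open>Uniform in \<open>n\<close>: since \<open>\<Psi>\<close> has Lipschitz constant 1, the
  two ramp terms differ by at most \<open>n * (2 * front \<sigma> t)\<close> before the division by
  \<open>n\<close>.\<close>

lemma smoothed_bound:
  assumes "\<sigma> > 0" "\<alpha> \<le> lam" "0 \<le> \<alpha>" "n > 0"
  shows "\<bar>smoothed \<Phi> \<Psi> \<alpha> lam \<sigma> n (x, t)\<bar> \<le> lam * \<bar>x\<bar> + (lam - \<alpha>) * (4 * front \<sigma> t)"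
proof -
  let ?a = "front \<sigma> t"
  define v where "v = 2 * ?a * \<Phi> (n * x) + (\<Psi> (n * (x - ?a)) / n - \<Psi> (n * (x + ?a)) / n)"
  have a: "0 \<le> ?a" using front_nonneg assms by simp
  then have le: "n * (x - ?a) \<le> n * (x + ?a)"
    using assms by simp
  have d: "\<Psi> (n * (x + ?a)) - \<Psi> (n * (x - ?a)) \<le> n * (2 * ?a)"
    using \<Psi>_Lipschitz(2)[OF le] by (simp add: algebra_simps)
  have "0 \<le> (\<Psi> (n * (x + ?a)) - \<Psi> (n * (x - ?a))) / n"
    using \<Psi>_Lipschitz(1)[OF le] assms by simp
  moreover have "(\<Psi> (n * (x + ?a)) - \<Psi> (n * (x - ?a))) / n \<le> 2 * ?a"
    using d assms by (simp add: divide_le_eq mult.commute)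
  moreover have "0 \<le> 2 * ?a * \<Phi> (n * x)" "2 * ?a * \<Phi> (n * x) \<le> 2 * ?a * 1"
    by (rule mult_nonneg_nonneg, use a in simp, rule \<Phi>_bounds)
      (rule mult_left_mono, rule \<Phi>_bounds, use a in simp)
  ultimately have "\<bar>v\<bar> \<le> 4 * ?a"
    unfolding v_def by (simp add: diff_divide_distrib)
  then have "\<bar>(lam - \<alpha>) * v\<bar> \<le> (lam - \<alpha>) * (4 * ?a)"
    using assms by (simp add: abs_mult mult_left_mono)
  moreover have "\<bar>lam * x\<bar> = lam * \<bar>x\<bar>"
    using assms by (simp add: abs_mult)
  ultimately show ?thesis
    unfolding smoothed_def v_def[symmetric] prod.case by linarith
qed

text \<open>The kernel term is nonnegative and the difference of the two \<open>\<Phi>\<close> terms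
  is at least -1. This keeps the argument of \<open>\<tau>\<close> positive and bounds the stress
  from below.\<close>

lemma smoothed_x_lower:
  assumes "\<sigma> > 0" "\<alpha> \<le> lam" "n > 0"
  shows "\<alpha> \<le> smoothed_x \<phi> \<Phi> \<alpha> lam \<sigma> n (x, t)"
proof -
  have "0 \<le> 2 * front \<sigma> t * (n * \<phi> (n * x))"
    using front_nonneg[of \<sigma> t] \<phi>_nonneg assms by simp
  with \<Phi>_bounds(1)[of "n * (x - front \<sigma> t)"] \<Phi>_bounds(2)[of "n * (x + front \<sigma> t)"]
  have "- 1 \<le> 2 * front \<sigma> t * (n * \<phi> (n * x)) + (\<Phi> (n * (x - front \<sigma> t)) - \<Phi> (n * (x + front \<sigma> t)))"
    by linarith
  then have "(lam - \<alpha>) * - 1 \<le> (lam - \<alpha>) * (2 * front \<sigma> t * (n * \<phi> (n * x))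
      + (\<Phi> (n * (x - front \<sigma> t)) - \<Phi> (n * (x + front \<sigma> t))))"
    using assms by (intro mult_left_mono) auto
  then show ?thesis
    by (simp add: smoothed_x_def)
qed

text \<open>Monotonicity of \<open>\<Phi>\<close> makes the front terms nonpositive, so only the
  kernel at \<open>x = 0\<close> can lift the slope above \<open>lam\<close>.\<close>

lemma smoothed_x_upper:
  assumes "\<sigma> > 0" "\<alpha> \<le> lam" "n > 0"
  shows "smoothed_x \<phi> \<Phi> \<alpha> lam \<sigma> n (x, t) \<le> lam + (lam - \<alpha>) * (2 * front \<sigma> t * (n * \<phi> (n * x)))"
proof -
  have "n * (x - front \<sigma> t) \<le> n * (x + front \<sigma> t)"
    using front_nonneg[of \<sigma> t] assms by simp
  from \<Phi>_mono[OF this] assms show ?thesis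
    by (simp add: smoothed_x_def mult_left_mono)
qed

lemma eventually_primitives:
  assumes "r \<noteq> 0"
  shows "\<forall>\<^sub>F n in sequentially. \<phi> (real n * r) = 0 \<and> \<Phi> (real n * r) = indicator {0..} r
    \<and> \<Psi> (real n * r) / real n = max 0 r"
proof -
  have "\<forall>\<^sub>F n in sequentially. real n \<ge> 1 / \<bar>r\<bar>"
    using eventually_ge_at_top[of "nat \<lceil>1 / \<bar>r\<bar>\<rceil>"] by eventually_elim linarith
  moreover have "\<forall>\<^sub>F n in sequentially. n > (0 :: nat)"
    by (rule eventually_gt_at_top)
  ultimately show ?thesis
  proof eventually_elim
    case (elim n)
    then have "1 \<le> real n * \<bar>r\<bar>"
      using assms by (simp add: field_simps)
    then show ?case
      using left[of "real n * r"] right[of "real n * r"] \<phi>_vanish[of "real n * r"] assms elim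
      by (cases "r > 0") (auto simp: abs_mult)
  qed
qed

lemma eventually_smoothed:
  assumes "\<sigma> > 0" "x \<noteq> 0" "x \<noteq> front \<sigma> t" "x \<noteq> - front \<sigma> t"
  shows "\<forall>\<^sub>F n in sequentially. smoothed \<Phi> \<Psi> \<alpha> lam \<sigma> (real n) (x, t) = profile \<alpha> lam \<sigma> x t
    \<and> smoothed_x \<phi> \<Phi> \<alpha> lam \<sigma> (real n) (x, t) = (if \<bar>x\<bar> < front \<sigma> t then \<alpha> else lam)"
proof -
  have nz: "x - front \<sigma> t \<noteq> 0" "x + front \<sigma> t \<noteq> 0"
    using assms by auto
  show ?thesis
    using eventually_primitives[OF assms(2)] eventually_primitives[OF nz(1)] eventually_primitives[OF nz(2)]
  proof eventually_elim
    case (elim n)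
    have "indicator {0..} (x - front \<sigma> t) - indicator {0..} (x + front \<sigma> t) = (if \<bar>x\<bar> < front \<sigma> t then -1 else (0::real))"
      using assms front_nonneg[of \<sigma> t] by (auto simp: indicator_def)
    with elim show ?case
      by (simp add: smoothed_def smoothed_x_def profile_def)
  qed
qed

end

subsection \<open>The limiting weak formulation\<close>

lemma integrable_bounded_on_cbox:
  fixes f :: "'a::euclidean_space \<Rightarrow> real"
  assumes "f \<in> borel_measurable borel" "\<And>p. \<bar>f p\<bar> \<le> B" "\<And>p. p \<notin> cbox a b \<Longrightarrow> f p = 0"
  shows "integrable lborel f"
proof (rule Bochner_Integration.integrable_bound)
  show "integrable lborel (\<lambda>p. B * indicator (cbox a b) p :: real)"
    by (intro integrable_mult_right integrable_real_indicator) (use emeasure_bounded_finite[OF bounded_cbox, of a b] in \<open>simp_all add: less_top[symmetric]\<close>)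
  show "AE p in lborel. norm (f p) \<le> norm (B * indicator (cbox a b) p :: real)"
    using assms(2,3) by (intro AE_I2) (auto simp: indicator_def intro: order_trans[OF _ abs_ge_self])
qed (use assms in simp)

lemma bounded_if_vanishing_outside_cbox:
  fixes f :: "'a::euclidean_space \<Rightarrow> real"
  assumes "continuous_on UNIV f" "\<And>p. p \<notin> cbox a b \<Longrightarrow> f p = 0"
  obtains K where "K > 0" "\<And>p. \<bar>f p\<bar> \<le> K"
proof -
  obtain K where K: "\<And>p. p \<in> cbox a b \<Longrightarrow> norm (f p) \<le> K"
    using compact_imp_bounded[OF compact_continuous_image[OF continuous_on_subset[OF assms(1)] compact_cbox]]
    unfolding bounded_iff by (metis imageI subset_UNIV)
  show thesis
  proof (rule that[of "\<bar>K\<bar> + 1"])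
    show "\<bar>f p\<bar> \<le> \<bar>K\<bar> + 1" for p
      using K[of p] assms(2)[of p] by (cases "p \<in> cbox a b") auto
  qed simp
qed

lemma integrable_if_vanishing_outside_cbox:
  fixes f :: "'a::euclidean_space \<Rightarrow> real"
  assumes "continuous_on UNIV f" "\<And>p. p \<notin> cbox a b \<Longrightarrow> f p = 0"
  shows "integrable lborel f"
proof -
  obtain K where "\<And>p. \<bar>f p\<bar> \<le> K"
    using bounded_if_vanishing_outside_cbox[OF assms] by blast
  with assms show ?thesis
    by (intro integrable_bounded_on_cbox borel_measurable_continuous_onI)
qed

text \<open>Both orders are needed: the \<open>\<psi>tt\<close> term is integrated in time first,
  the \<open>\<psi>x\<close> terms in space first.\<close>

lemma lborel_Fubini:
  fixes f :: "real \<times> real \<Rightarrow> real"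
  assumes "integrable lborel f"
  shows "(LINT x|lborel. LINT t|lborel. f (x, t)) = (LINT p|lborel. f p)"
    and "(LINT t|lborel. LINT x|lborel. f (x, t)) = (LINT p|lborel. f p)"
proof -
  have f: "integrable (lborel \<Otimes>\<^sub>M lborel) f"
    using assms by (simp add: lborel_prod)
  show "(LINT x|lborel. LINT t|lborel. f (x, t)) = (LINT p|lborel. f p)"
    using lborel_pair.integral_fst'[OF f] by (simp add: lborel_prod)
  show "(LINT t|lborel. LINT x|lborel. f (x, t)) = (LINT p|lborel. f p)"
    using lborel_pair.integral_snd[of "\<lambda>x t. f (x, t)"] f by (simp add: lborel_prod)
qed

lemma has_bochner_integral_FTC_vanishing:
  fixes F f :: "real \<Rightarrow> real"
  assumes "\<And>s. (F has_real_derivative f s) (at s)" "continuous_on UNIV f"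
    and "\<And>s. R \<le> s \<Longrightarrow> F s = 0 \<and> f s = 0"
  shows "has_bochner_integral lborel (\<lambda>s. f s * indicator {c..} s) (- F c)"
proof -
  \<comment> \<open>The maximum puts the right endpoint where \<open>F\<close> vanishes, also when
    \<open>c\<close> already lies beyond \<open>R\<close>.\<close>
  have "has_bochner_integral lborel (\<lambda>s. f s * indicator {c..max c R} s) (F (max c R) - F c)"
    using assms(1,2) by (intro has_bochner_integral_FTC_Icc_real) (auto simp: continuous_on_eq_continuous_at)
  moreover have "f s * indicator {c..max c R} s = f s * indicator {c..} s" for s
    using assms(3)[of s] by (auto simp: indicator_def)
  ultimately show ?thesis
    using assms(3)[of "max c R"] by simp
qed

section \<open>Integrals of test function derivatives over half lines, strips and fronts\<close>

context space_time_bump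
begin

lemma vanish_cbox:
  assumes "p \<notin> cbox (- R, - R) (R, R)"
  shows "\<psi> p = 0" "\<psi>x p = 0" "\<psi>t p = 0" "\<psi>tt p = 0"
proof -
  obtain x t where p: "p = (x, t)" by fastforce
  have "R \<le> \<bar>x\<bar> \<or> R \<le> \<bar>t\<bar>"
    using assms unfolding p cbox_Pair_eq by auto
  then show "\<psi> p = 0" "\<psi>x p = 0" "\<psi>t p = 0" "\<psi>tt p = 0"
    using vanish p by auto
qed

lemma continuous_slices:
  "continuous_on UNIV (\<lambda>x. \<psi>x (x, t))"
  "continuous_on UNIV (\<lambda>t. \<psi>tt (x, t))"
  by (rule continuous_on_compose2[OF cont(2)] continuous_on_compose2[OF cont(4)];
      auto intro!: continuous_intros)+

lemma integral_\<psi>x: "has_bochner_integral lborel (\<lambda>x. \<psi>x (x, t)) 0"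
proof -
  have "has_bochner_integral lborel (\<lambda>x. \<psi>x (x, t) * indicator {- R..} x) (- \<psi> (- R, t))"
    by (rule has_bochner_integral_FTC_vanishing[OF deriv_x continuous_slices(1), of R]) (simp add: vanish order_trans[OF _ abs_ge_self])
  moreover have "\<psi>x (x, t) * indicator {- R..} x = \<psi>x (x, t)" for x
    using vanish[of x t] by (cases "R \<le> \<bar>x\<bar>") (auto simp: indicator_def not_le abs_less_iff)
  ultimately show ?thesis
    using vanish[of "- R" t] R_pos by simp
qed

lemma integral_\<psi>tt: "has_bochner_integral lborel (\<lambda>t. \<psi>tt (x, t)) 0"
proof -
  have "has_bochner_integral lborel (\<lambda>t. \<psi>tt (x, t) * indicator {- R..} t) (- \<psi>t (x, - R))"
    by (rule has_bochner_integral_FTC_vanishing[OF deriv_tt continuous_slices(2), of R]) (simp add: vanish order_trans[OF _ abs_ge_self])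
  moreover have "\<psi>tt (x, t) * indicator {- R..} t = \<psi>tt (x, t)" for t
    using vanish[of x t] by (cases "R \<le> \<bar>t\<bar>") (auto simp: indicator_def not_le abs_less_iff)
  ultimately show ?thesis
    using vanish[of x "- R"] R_pos by simp
qed

text \<open>For nonnegative \<open>a\<close> the factor is the indicator of
  \<open>{- a..<a}\<close>; as a difference of half lines it needs no condition on
  \<open>a\<close>.\<close>

lemma integral_strip:
  "has_bochner_integral lborel (\<lambda>x. (indicator {- a..} x - indicator {a..} x) * \<psi>x (x, t)) (\<psi> (a, t) - \<psi> (- a, t))"
proof -
  have "has_bochner_integral lborel (\<lambda>x. \<psi>x (x, t) * indicator {c..} x) (- \<psi> (c, t))" for c
    by (rule has_bochner_integral_FTC_vanishing[OF deriv_x continuous_slices(1), of R]) (simp add: vanish order_trans[OF _ abs_ge_self])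
  from has_bochner_integral_diff[OF this[of "- a"] this[of a]] show ?thesis
    by (simp add: algebra_simps)
qed

text \<open>The second derivative of a ramp is a point mass at its corner; \<open>F\<close> in the
  proof is the result of integrating by parts twice.\<close>

lemma integral_ramp:
  "has_bochner_integral lborel (\<lambda>t. max 0 (t - b) * \<psi>tt (x, t)) (\<psi> (x, b))"
proof -
  define F where "F t = (t - b) * \<psi>t (x, t) - \<psi> (x, t)" for t
  have "(F has_real_derivative (t - b) * \<psi>tt (x, t)) (at t)" for t
    unfolding F_def by (rule derivative_eq_intros deriv_t deriv_tt refl | simp)+
  moreover have "continuous_on UNIV (\<lambda>t. (t - b) * \<psi>tt (x, t))"
    by (intro continuous_on_mult continuous_slices continuous_intros)
  ultimately have "has_bochner_integral lborel (\<lambda>t. (t - b) * \<psi>tt (x, t) * indicator {b..} t) (- F b)"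
    by (rule has_bochner_integral_FTC_vanishing[of _ _ R]) (simp add: F_def vanish order_trans[OF _ abs_ge_self])
  moreover have "(t - b) * \<psi>tt (x, t) * indicator {b..} t = max 0 (t - b) * \<psi>tt (x, t)" for t
    by (auto simp: indicator_def)
  ultimately show ?thesis
    by (simp add: F_def)
qed

text \<open>At a fixed place the profile rests at \<open>lam * x\<close> until the front arrives at
  time \<open>\<bar>x\<bar> / \<sigma>\<close>, and from then on moves with velocity
  \<open>(lam - \<alpha>) * \<sigma> * sgn x\<close>. Only the corner at the arrival time
  contributes.\<close>

lemma integral_profile_\<psi>tt:
  assumes "\<sigma> > 0" "x \<noteq> 0"
  shows "(LINT t|lborel. profile \<alpha> lam \<sigma> x t * \<psi>tt (x, t)) = (lam - \<alpha>) * \<sigma> * (sgn x * \<psi> (x, \<bar>x\<bar> / \<sigma>))"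
proof -
  have "profile \<alpha> lam \<sigma> x t * \<psi>tt (x, t)
      = lam * x * \<psi>tt (x, t) + (lam - \<alpha>) * \<sigma> * sgn x * (max 0 (t - \<bar>x\<bar> / \<sigma>) * \<psi>tt (x, t))" for t
  proof -
    have "max \<bar>x\<bar> (front \<sigma> t) = \<bar>x\<bar> + \<sigma> * max 0 (t - \<bar>x\<bar> / \<sigma>)"
    proof (cases "\<bar>x\<bar> \<le> \<sigma> * t")
      case True
      then have "0 < t"
        using assms by (smt (verit) zero_less_mult_pos)
      with True assms show ?thesis
        by (simp add: front_def max_def field_simps)
    next
      case False
      then have "t < \<bar>x\<bar> / \<sigma>" "\<sigma> * max 0 t < \<bar>x\<bar>"
        using assms by (auto simp: field_simps max_def)
      then show ?thesis
        by (simp add: front_def)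
    qed
    then have "profile \<alpha> lam \<sigma> x t = \<alpha> * x + (lam - \<alpha>) * (sgn x * \<bar>x\<bar> + sgn x * (\<sigma> * max 0 (t - \<bar>x\<bar> / \<sigma>)))"
      using profile_eq_sgn[OF assms] by (simp add: distrib_left)
    also have "sgn x * \<bar>x\<bar> = x"
      by (simp add: sgn_mult_abs)
    finally have "profile \<alpha> lam \<sigma> x t = lam * x + (lam - \<alpha>) * \<sigma> * sgn x * max 0 (t - \<bar>x\<bar> / \<sigma>)"
      by (simp add: algebra_simps)
    then show ?thesis
      by (simp add: distrib_right)
  qed
  moreover have "has_bochner_integral lborel
      (\<lambda>t. lam * x * \<psi>tt (x, t) + (lam - \<alpha>) * \<sigma> * sgn x * (max 0 (t - \<bar>x\<bar> / \<sigma>) * \<psi>tt (x, t)))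
      (lam * x * 0 + (lam - \<alpha>) * \<sigma> * sgn x * \<psi> (x, \<bar>x\<bar> / \<sigma>))"
    by (intro has_bochner_integral_add has_bochner_integral_mult_right integral_\<psi>tt integral_ramp)
  ultimately show ?thesis
    by (simp add: has_bochner_integral_integral_eq)
qed

text \<open>Reflecting time on the left front joins both half lines into the single curve
  \<open>(\<sigma> * t, \<bar>t\<bar>)\<close>, the form in which the \<open>\<psi>tt\<close> term
  arrives as well. Nonpositive times drop out on the left because the two fronts coincide
  there.\<close>

lemma integral_fronts:
  assumes "\<sigma> > 0"
  shows "(LINT t|lborel. \<psi> (front \<sigma> t, t) - \<psi> (- front \<sigma> t, t)) = (LINT t|lborel. sgn t * \<psi> (\<sigma> * t, \<bar>t\<bar>))"
proof -
  define f where "f c t = indicator {0<..} t * \<psi> (c * t, t)" for c t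
  have int: "integrable lborel (f c)" for c
  proof -
    obtain K where K: "K > 0" "\<And>p. \<bar>\<psi> p\<bar> \<le> K"
      using bounded_if_vanishing_outside_cbox[OF cont(1) vanish_cbox(1)] by blast
    have "(\<lambda>t. \<psi> (c * t, t)) \<in> borel_measurable borel"
      by (intro borel_measurable_continuous_onI continuous_on_compose2[OF cont(1)] continuous_intros) auto
    then have "f c \<in> borel_measurable borel"
      unfolding f_def by measurable
    moreover have "\<bar>f c t\<bar> \<le> K" for t
      using K by (auto simp: f_def indicator_def less_imp_le)
    moreover have "f c t = 0" if "t \<notin> cbox (- R) R" for t
    proof -
      have "R \<le> \<bar>t\<bar>"
        using that by auto
      then show ?thesis
        by (simp add: f_def vanish)
    qed
    ultimately show ?thesis
      by (rule integrable_bounded_on_cbox)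
  qed
  have "(LINT t|lborel. \<psi> (front \<sigma> t, t) - \<psi> (- front \<sigma> t, t)) = (LINT t|lborel. f \<sigma> t - f (- \<sigma>) t)"
    by (intro Bochner_Integration.integral_cong) (auto simp: f_def front_def indicator_def max_def)
  also have "\<dots> = (LINT t|lborel. f \<sigma> t) - (LINT t|lborel. f (- \<sigma>) t)"
    by (intro Bochner_Integration.integral_diff int)
  also have "(LINT t|lborel. f (- \<sigma>) t) = (LINT t|lborel. f (- \<sigma>) (- t))"
    by (subst lborel_integral_real_affine[where c = "- 1" and t = 0]) auto
  also have "(LINT t|lborel. f \<sigma> t) - (LINT t|lborel. f (- \<sigma>) (- t)) = (LINT t|lborel. f \<sigma> t - f (- \<sigma>) (- t))"
    using lborel_integrable_real_affine[OF int, of "- 1" "- \<sigma>" 0]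
    by (intro Bochner_Integration.integral_diff[symmetric] int) simp
  also have "\<dots> = (LINT t|lborel. sgn t * \<psi> (\<sigma> * t, \<bar>t\<bar>))"
    by (intro Bochner_Integration.integral_cong) (auto simp: f_def indicator_def sgn_if)
  finally show ?thesis .
qed

lemma integrable_limit_terms:
  assumes "\<sigma> > 0" "\<alpha> \<le> lam" "0 \<le> \<alpha>"
  shows "integrable lborel (\<lambda>p. profile \<alpha> lam \<sigma> (fst p) (snd p) * \<psi>tt p)"
    and "integrable lborel \<psi>x"
    and "integrable lborel
      (\<lambda>p. (indicator {- front \<sigma> (snd p)..} (fst p) - indicator {front \<sigma> (snd p)..} (fst p)) * \<psi>x p)"
proof -
  have [measurable]: "\<psi>x \<in> borel_measurable borel" "\<psi>tt \<in> borel_measurable borel"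
    by (intro borel_measurable_continuous_onI cont)+
  obtain K where K: "K > 0" "\<And>p. \<bar>\<psi>tt p\<bar> \<le> K"
    using bounded_if_vanishing_outside_cbox[OF cont(4) vanish_cbox(4)] by blast
  obtain L where L: "L > 0" "\<And>p. \<bar>\<psi>x p\<bar> \<le> L"
    using bounded_if_vanishing_outside_cbox[OF cont(2) vanish_cbox(2)] by blast
  show "integrable lborel \<psi>x"
    by (rule integrable_if_vanishing_outside_cbox[OF cont(2) vanish_cbox(2)])
  show "integrable lborel (\<lambda>p. profile \<alpha> lam \<sigma> (fst p) (snd p) * \<psi>tt p)"
  proof (rule integrable_bounded_on_cbox[where a = "(- R, - R)" and b = "(R, R)"])
    show "\<bar>profile \<alpha> lam \<sigma> (fst p) (snd p) * \<psi>tt p\<bar> \<le> (lam * R + (lam - \<alpha>) * (4 * (\<sigma> * R))) * K" for p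
    proof (cases "p \<in> cbox (- R, - R) (R, R)")
      case True
      then have "\<bar>fst p\<bar> \<le> R" "front \<sigma> (snd p) \<le> \<sigma> * R"
        using assms R_pos by (cases p; auto simp: cbox_Pair_eq front_def)+
      then have "lam * \<bar>fst p\<bar> + (lam - \<alpha>) * (4 * front \<sigma> (snd p)) \<le> lam * R + (lam - \<alpha>) * (4 * (\<sigma> * R))"
        using assms by (intro add_mono mult_left_mono) auto
      then have "\<bar>profile \<alpha> lam \<sigma> (fst p) (snd p)\<bar> \<le> lam * R + (lam - \<alpha>) * (4 * (\<sigma> * R))"
        using profile_bound[OF assms] order_trans by blast
      then show ?thesis
        unfolding abs_mult using K by (intro mult_mono) (auto intro: order_trans[OF abs_ge_zero])
    next
      case False
      then show ?thesis
        using vanish_cbox(4) assms K R_pos by simp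
    qed
    show "(\<lambda>p. profile \<alpha> lam \<sigma> (fst p) (snd p) * \<psi>tt p) \<in> borel_measurable borel"
      by measurable
  qed (simp add: vanish_cbox)
  show "integrable lborel
      (\<lambda>p. (indicator {- front \<sigma> (snd p)..} (fst p) - indicator {front \<sigma> (snd p)..} (fst p)) * \<psi>x p)"
  proof (rule integrable_bounded_on_cbox[where a = "(- R, - R)" and b = "(R, R)"])
    have [measurable]: "Measurable.pred borel (\<lambda>p :: real \<times> real. - front \<sigma> (snd p) \<le> fst p)"
      "Measurable.pred borel (\<lambda>p :: real \<times> real. front \<sigma> (snd p) \<le> fst p)"
      by (auto simp: pred_def intro!: borel_closed closed_Collect_le continuous_intros)
    have eq: "indicator {- front \<sigma> (snd p)..} (fst p) = (of_bool (- front \<sigma> (snd p) \<le> fst p) :: real)"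
      "indicator {front \<sigma> (snd p)..} (fst p) = (of_bool (front \<sigma> (snd p) \<le> fst p) :: real)" for p
      by auto
    show "(\<lambda>p. (indicator {- front \<sigma> (snd p)..} (fst p) - indicator {front \<sigma> (snd p)..} (fst p)) * \<psi>x p)
        \<in> borel_measurable borel"
      unfolding eq by measurable
    show "\<bar>(indicator {- front \<sigma> (snd p)..} (fst p) - indicator {front \<sigma> (snd p)..} (fst p)) * \<psi>x p\<bar> \<le> L" for p
      using L by (auto simp: indicator_def less_imp_le)
  qed (simp add: vanish_cbox)
qed

text \<open>The Rankine--Hugoniot condition: both terms reduce to the same integral of \<open>\<psi>\<close> along the fronts.\<close>

lemma shock_weak_solution:
  assumes "\<sigma> > 0" "\<alpha> \<le> lam" "0 \<le> \<alpha>" "(lam - \<alpha>) * \<sigma>\<^sup>2 = b - a"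
  shows "(LINT p|lborel. profile \<alpha> lam \<sigma> (fst p) (snd p) * \<psi>tt p + (b * \<psi>x p - (b - a) *
      ((indicator {- front \<sigma> (snd p)..} (fst p) - indicator {front \<sigma> (snd p)..} (fst p)) * \<psi>x p))) = 0"
proof -
  define J where "J = (LINT t|lborel. sgn t * \<psi> (\<sigma> * t, \<bar>t\<bar>))"
  note int = integrable_limit_terms[OF assms(1-3)]
  have "(LINT p|lborel. profile \<alpha> lam \<sigma> (fst p) (snd p) * \<psi>tt p)
      = (LINT x|lborel. LINT t|lborel. profile \<alpha> lam \<sigma> x t * \<psi>tt (x, t))"
    using lborel_Fubini(1)[OF int(1)] by simp
  also have "\<dots> = (LINT x|lborel. (lam - \<alpha>) * \<sigma> * (sgn x * \<psi> (x, \<bar>x\<bar> / \<sigma>)))"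
  proof (rule integral_cong_AE)
    show "AE x in lborel. (LINT t|lborel. profile \<alpha> lam \<sigma> x t * \<psi>tt (x, t)) = (lam - \<alpha>) * \<sigma> * (sgn x * \<psi> (x, \<bar>x\<bar> / \<sigma>))"
      using AE_lborel_singleton[of 0] by eventually_elim (rule integral_profile_\<psi>tt[OF assms(1)])
    show "(\<lambda>x. LINT t|lborel. profile \<alpha> lam \<sigma> x t * \<psi>tt (x, t)) \<in> borel_measurable lborel"
      using lborel_pair.integrable_fst'[of "\<lambda>p. profile \<alpha> lam \<sigma> (fst p) (snd p) * \<psi>tt p"] int(1)
      by (intro borel_measurable_integrable) (simp add: lborel_prod)
    have "(\<lambda>x. \<psi> (x, \<bar>x\<bar> / \<sigma>)) \<in> borel_measurable borel"
      using assms by (intro borel_measurable_continuous_onI continuous_on_compose2[OF cont(1)] continuous_intros) auto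
    then show "(\<lambda>x. (lam - \<alpha>) * \<sigma> * (sgn x * \<psi> (x, \<bar>x\<bar> / \<sigma>))) \<in> borel_measurable lborel"
      by measurable
  qed
  also have "\<dots> = (lam - \<alpha>) * \<sigma> * (LINT x|lborel. sgn x * \<psi> (x, \<bar>x\<bar> / \<sigma>))"
    by simp
  \<comment> \<open>The substitution \<open>x = \<sigma> * t\<close> from place to arrival time
    contributes the second factor \<open>\<sigma>\<close>, completing
    \<open>(lam - \<alpha>) * \<sigma>\<^sup>2\<close>.\<close>
  also have "(LINT x|lborel. sgn x * \<psi> (x, \<bar>x\<bar> / \<sigma>)) = \<sigma> * J"
    using assms(1) by (subst lborel_integral_real_affine[where c = \<sigma> and t = 0])
      (auto simp: J_def sgn_mult abs_mult)
  finally have 1: "(LINT p|lborel. profile \<alpha> lam \<sigma> (fst p) (snd p) * \<psi>tt p) = (b - a) * J"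
    by (simp add: assms(4)[symmetric] power2_eq_square)
  have 2: "(LINT p|lborel. \<psi>x p) = 0"
    using lborel_Fubini(2)[OF int(2)] by (simp add: has_bochner_integral_integral_eq[OF integral_\<psi>x])
  have 3: "(LINT p|lborel. (indicator {- front \<sigma> (snd p)..} (fst p) - indicator {front \<sigma> (snd p)..} (fst p)) * \<psi>x p) = J"
    using lborel_Fubini(2)[OF int(3)] integral_fronts[OF assms(1)]
    by (simp add: has_bochner_integral_integral_eq[OF integral_strip] J_def)
  show ?thesis
    using int by (simp add: 1 2 3)
qed

end

subsection \<open>Convergence of the mollified weak formulation\<close>

text \<open>Each line is the hyperplane orthogonal to \<open>(1, c)\<close> with \<open>c\<close>
  equal to 0, \<open>- \<sigma>\<close> or \<open>\<sigma>\<close>. The full lines are removed, so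
  the sign of time does not matter.\<close>

lemma AE_off_shock_lines:
  "AE p in lborel. fst p \<noteq> 0 \<and> fst p \<noteq> \<sigma> * snd p \<and> fst p \<noteq> - \<sigma> * (snd p :: real)"
proof -
  have "AE p in lborel. (1 :: real, c) \<bullet> p \<noteq> 0" for c :: real
  proof -
    have "negligible {p :: real \<times> real. (1, c) \<bullet> p = 0}"
      by (intro negligible_hyperplane) (simp add: zero_prod_def)
    then show ?thesis
      by (auto simp: negligible_iff_null_sets AE_completion_iff dest!: AE_not_in)
  qed
  from this[of 0] this[of "- \<sigma>"] this[of \<sigma>] show ?thesis
    by eventually_elim (auto simp: inner_prod_def)
qed

locale mollified_shock = mollifier_primitives \<phi> \<Phi> \<Psi> + space_time_bump \<psi> \<psi>x \<psi>t \<psi>tt R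
  for \<phi> \<Phi> \<Psi> :: "real \<Rightarrow> real" and \<psi> \<psi>x \<psi>t \<psi>tt :: "real \<times> real \<Rightarrow> real" and R +
  fixes \<tau> :: "real \<Rightarrow> real" and \<alpha> lam \<sigma> :: real
  assumes \<tau>_cont: "continuous_on {0<..} \<tau>"
    and \<tau>_mono: "0 < u \<Longrightarrow> u \<le> v \<Longrightarrow> \<tau> u \<le> \<tau> v"
    and \<tau>_sublinear: "((\<lambda>u. \<tau> u / u) \<longlongrightarrow> 0) at_top"
    and \<alpha>_pos: "0 < \<alpha>" and \<alpha>_less: "\<alpha> < lam" and \<sigma>_pos: "0 < \<sigma>"
    and rankine_hugoniot: "(lam - \<alpha>) * \<sigma>\<^sup>2 = \<tau> lam - \<tau> \<alpha>"
begin

abbreviation "S n \<equiv> smoothed \<Phi> \<Psi> \<alpha> lam \<sigma> (real n)"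
abbreviation "Sx n \<equiv> smoothed_x \<phi> \<Phi> \<alpha> lam \<sigma> (real n)"

text \<open>The cap is inactive where the slope is at most \<open>lam\<close>, in particular
  wherever \<open>1 \<le> \<bar>real n * x\<bar>\<close>, and it makes the stress bounded uniformly
  in \<open>n\<close>.\<close>

definition truncated :: "nat \<Rightarrow> real \<times> real \<Rightarrow> real" where
  "truncated n p = S n p * \<psi>tt p + min (\<tau> (Sx n p)) (\<tau> lam) * \<psi>x p"

text \<open>Nonzero only on the strip \<open>\<bar>x\<bar> < 1/n\<close> where the jump at \<open>x = 0\<close> is smoothed out.\<close>

definition excess :: "nat \<Rightarrow> real \<times> real \<Rightarrow> real" where
  "excess n p = max (\<tau> (Sx n p) - \<tau> lam) 0 * \<psi>x p"

lemma truncated_plus_excess: "truncated n p + excess n p = S n p * \<psi>tt p + \<tau> (Sx n p) * \<psi>x p"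
  by (cases "\<tau> (Sx n p) \<le> \<tau> lam") (simp_all add: truncated_def excess_def algebra_simps)

lemma Sx_lower: "n \<ge> 1 \<Longrightarrow> \<alpha> \<le> Sx n p"
  using smoothed_x_lower[of \<sigma> \<alpha> lam "real n" "fst p" "snd p"] \<sigma>_pos \<alpha>_less by simp

lemma continuous_\<tau>_Sx: "n \<ge> 1 \<Longrightarrow> continuous_on UNIV (\<lambda>p. \<tau> (Sx n p))"
  using Sx_lower \<alpha>_pos
  by (intro continuous_on_compose2[OF \<tau>_cont continuous_smoothed_x]) (auto intro: less_le_trans)

lemma continuous_truncated: "n \<ge> 1 \<Longrightarrow> continuous_on UNIV (truncated n)"
  unfolding truncated_def[abs_def]
  by (intro continuous_on_add continuous_on_mult continuous_on_min continuous_on_const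
      continuous_smoothed continuous_\<tau>_Sx cont)

lemma continuous_excess: "n \<ge> 1 \<Longrightarrow> continuous_on UNIV (excess n)"
  unfolding excess_def[abs_def]
  by (intro continuous_on_mult continuous_on_diff continuous_on_max continuous_on_const continuous_\<tau>_Sx cont)

lemma vanish_truncated: "p \<notin> cbox (- R, - R) (R, R) \<Longrightarrow> truncated n p = 0"
  and vanish_excess: "p \<notin> cbox (- R, - R) (R, R) \<Longrightarrow> excess n p = 0"
  by (simp_all add: truncated_def excess_def vanish_cbox)

lemma integrable_truncated: "n \<ge> 1 \<Longrightarrow> integrable lborel (truncated n)"
  by (rule integrable_if_vanishing_outside_cbox[OF continuous_truncated vanish_truncated])

lemma integrable_excess: "n \<ge> 1 \<Longrightarrow> integrable lborel (excess n)"
  by (rule integrable_if_vanishing_outside_cbox[OF continuous_excess vanish_excess])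

lemma truncated_limit: "(\<lambda>n. LINT p|lborel. truncated (Suc n) p) \<longlonglongrightarrow> 0"
proof -
  \<comment> \<open>The limiting stress is \<open>\<tau> lam\<close> outside the fronts and drops by
    \<open>\<tau> lam - \<tau> \<alpha>\<close> between them; the cap does not affect this limit
    since \<open>\<tau> \<alpha> \<le> \<tau> lam\<close>.\<close>
  define g where "g p = profile \<alpha> lam \<sigma> (fst p) (snd p) * \<psi>tt p + (\<tau> lam * \<psi>x p - (\<tau> lam - \<tau> \<alpha>) *
      ((indicator {- front \<sigma> (snd p)..} (fst p) - indicator {front \<sigma> (snd p)..} (fst p)) * \<psi>x p))" for p
  obtain K where K: "K > 0" "\<And>p. \<bar>\<psi>tt p\<bar> \<le> K"
    using bounded_if_vanishing_outside_cbox[OF cont(4) vanish_cbox(4)] by blast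
  obtain L where L: "L > 0" "\<And>p. \<bar>\<psi>x p\<bar> \<le> L"
    using bounded_if_vanishing_outside_cbox[OF cont(2) vanish_cbox(2)] by blast
  \<comment> \<open>On the square of half-width \<open>R\<close> the first summand comes from
    \<open>smoothed_bound\<close> with \<open>front \<sigma> t \<le> \<sigma> * R\<close>; in the
    second, the capped stress lies between \<open>\<tau> \<alpha>\<close> and
    \<open>\<tau> lam\<close>.\<close>
  define C where "C = (lam * R + (lam - \<alpha>) * (4 * (\<sigma> * R))) * K + (\<bar>\<tau> \<alpha>\<bar> + \<bar>\<tau> lam\<bar>) * L"
  have "g \<in> borel_measurable lborel"
    using integrable_limit_terms[of \<sigma> \<alpha> lam] \<sigma>_pos \<alpha>_less \<alpha>_pos unfolding g_def
    by (intro borel_measurable_integrable Bochner_Integration.integrable_add Bochner_Integration.integrable_diff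
        integrable_mult_right) auto
  moreover have "truncated (Suc n) \<in> borel_measurable lborel" for n
    using integrable_truncated by (intro borel_measurable_integrable) simp
  moreover have "integrable lborel (\<lambda>p. C * indicator (cbox (- R, - R) (R, R)) p)"
    by (intro integrable_mult_right integrable_real_indicator)
      (use emeasure_bounded_finite[OF bounded_cbox, of "(- R, - R)" "(R, R)"] in \<open>simp_all add: less_top[symmetric]\<close>)
  moreover have "AE p in lborel. (\<lambda>n. truncated (Suc n) p) \<longlonglongrightarrow> g p"
  proof -
    show ?thesis
      using AE_off_shock_lines[of \<sigma>]
    proof eventually_elim
      case (elim p)
      obtain x t where p: "p = (x, t)" by fastforce
      have ne: "x \<noteq> 0" "x \<noteq> front \<sigma> t" "x \<noteq> - front \<sigma> t"
        using elim by (auto simp: p front_def max_def)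
      have "\<forall>\<^sub>F n in sequentially. truncated n p = g p"
        using eventually_smoothed[OF \<sigma>_pos ne, of \<alpha> lam]
      proof eventually_elim
        case (elim n)
        have "\<tau> \<alpha> \<le> \<tau> lam"
          using \<tau>_mono[of \<alpha> lam] \<alpha>_pos \<alpha>_less by simp
        with elim ne front_nonneg[OF \<sigma>_pos, of t] show ?case
          by (auto simp: p truncated_def g_def indicator_def algebra_simps)
      qed
      then show ?case
        using filterlim_sequentially_Suc[of "\<lambda>n. truncated n p"] by (simp add: tendsto_eventually)
    qed
  qed
  moreover have "AE p in lborel. norm (truncated (Suc n) p) \<le> C * indicator (cbox (- R, - R) (R, R)) p" for n
  proof (rule AE_I2)
    fix p :: "real \<times> real"
    obtain x t where p: "p = (x, t)" by fastforce
    show "norm (truncated (Suc n) p) \<le> C * indicator (cbox (- R, - R) (R, R)) p"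
    proof (cases "p \<in> cbox (- R, - R) (R, R)")
      case True
      then have "\<bar>x\<bar> \<le> R" "front \<sigma> t \<le> \<sigma> * R"
        using \<sigma>_pos R_pos by (auto simp: p cbox_Pair_eq front_def)
      then have "lam * \<bar>x\<bar> + (lam - \<alpha>) * (4 * front \<sigma> t) \<le> lam * R + (lam - \<alpha>) * (4 * (\<sigma> * R))"
        using \<alpha>_less \<alpha>_pos by (intro add_mono mult_left_mono) auto
      then have "\<bar>S (Suc n) p\<bar> \<le> lam * R + (lam - \<alpha>) * (4 * (\<sigma> * R))"
        using smoothed_bound[of \<sigma> \<alpha> lam "real (Suc n)" x t] \<sigma>_pos \<alpha>_less \<alpha>_pos by (simp add: p)
      then have 1: "\<bar>S (Suc n) p * \<psi>tt p\<bar> \<le> (lam * R + (lam - \<alpha>) * (4 * (\<sigma> * R))) * K"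
        unfolding abs_mult by (rule mult_mono) (use K \<open>\<bar>S (Suc n) p\<bar> \<le> _\<close> in \<open>auto intro: order_trans[OF abs_ge_zero]\<close>)
      have "\<tau> \<alpha> \<le> \<tau> (Sx (Suc n) p)"
        using \<tau>_mono[OF \<alpha>_pos Sx_lower[of "Suc n" p]] by (simp del: of_nat_Suc)
      moreover have "\<tau> \<alpha> \<le> \<tau> lam"
        using \<tau>_mono[of \<alpha> lam] \<alpha>_pos \<alpha>_less by simp
      ultimately have "\<bar>min (\<tau> (Sx (Suc n) p)) (\<tau> lam)\<bar> \<le> \<bar>\<tau> \<alpha>\<bar> + \<bar>\<tau> lam\<bar>"
        by linarith
      then have 2: "\<bar>min (\<tau> (Sx (Suc n) p)) (\<tau> lam) * \<psi>x p\<bar> \<le> (\<bar>\<tau> \<alpha>\<bar> + \<bar>\<tau> lam\<bar>) * L"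
        unfolding abs_mult[of _ "\<psi>x p"] by (rule mult_mono) (use L in auto)
      from 1 2 True show ?thesis
        unfolding truncated_def C_def by (auto intro: order_trans[OF abs_triangle_ineq] add_mono)
    qed (simp add: vanish_truncated)
  qed
  ultimately have "(\<lambda>n. LINT p|lborel. truncated (Suc n) p) \<longlonglongrightarrow> (LINT p|lborel. g p)"
    by (rule integral_dominated_convergence)
  also have "(LINT p|lborel. g p) = 0"
    unfolding g_def
    using shock_weak_solution[of \<sigma> \<alpha> lam "\<tau> lam" "\<tau> \<alpha>"] rankine_hugoniot \<sigma>_pos \<alpha>_less \<alpha>_pos by simp
  finally show ?thesis .
qed

lemma excess_limit: "(\<lambda>n. LINT p|lborel. excess (Suc n) p) \<longlonglongrightarrow> 0"
proof -
  obtain P where P: "P > 0" "\<And>s. \<phi> s \<le> P"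
    using \<phi>_bounded by blast
  obtain L where L: "L > 0" "\<And>p. \<bar>\<psi>x p\<bar> \<le> L"
    using bounded_if_vanishing_outside_cbox[OF cont(2) vanish_cbox(2)] by blast
  \<comment> \<open>Insert \<open>front \<sigma> t \<le> \<sigma> * R\<close> and
    \<open>\<phi> \<le> P\<close> into \<open>smoothed_x_upper\<close>: on the support the slope is
    at most \<open>lam + C * n\<close>, so \<open>M n\<close> bounds the stress above
    \<open>\<tau> lam\<close>.\<close>
  define C where "C = (lam - \<alpha>) * (2 * (\<sigma> * R) * P)"
  have "C > 0"
    using P \<alpha>_less \<sigma>_pos R_pos by (simp add: C_def)
  define M where "M n = \<tau> (lam + C * real n) - \<tau> lam" for n
  have M_nonneg: "M n \<ge> 0" for n
    using \<tau>_mono[of lam "lam + C * real n"] \<alpha>_pos \<alpha>_less \<open>C > 0\<close> by (simp add: M_def)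
  have bound: "\<bar>excess n p\<bar> \<le> M n * L * indicator (cbox (- (1 / n), - R) (1 / n, R)) p" if "n \<ge> 1" for n p
  proof -
    obtain x t where p: "p = (x, t)" by fastforce
    have n: "real n > 0" using that by simp
    \<comment> \<open>The excess vanishes in the first two cases, off the support and off the strip;
      only the third needs the growing bound \<open>M n\<close>.\<close>
    consider "p \<notin> cbox (- R, - R) (R, R)" | "1 \<le> \<bar>real n * x\<bar>"
      | "\<bar>real n * x\<bar> < 1" "p \<in> cbox (- R, - R) (R, R)"
      by linarith
    then show ?thesis
    proof cases
      case 1
      then show ?thesis
        using M_nonneg L by (simp add: vanish_excess)
    next
      case 2
      then have "Sx n p \<le> lam"
        using smoothed_x_upper[of \<sigma> \<alpha> lam "real n" x t] \<sigma>_pos \<alpha>_less n by (simp add: p \<phi>_vanish)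
      moreover have "0 < Sx n p"
        using Sx_lower[OF that, of p] \<alpha>_pos by linarith
      ultimately have "excess n p = 0"
        using \<tau>_mono[of "Sx n p" lam] by (simp add: excess_def)
      then show ?thesis
        using M_nonneg L by simp
    next
      case 3
      have "\<bar>x\<bar> < 1 / n"
        using 3 n by (simp add: abs_mult field_simps)
      then have ind: "p \<in> cbox (- (1 / n), - R) (1 / n, R)"
        using 3 by (auto simp: p cbox_Pair_eq)
      have "front \<sigma> t \<le> \<sigma> * R"
        using 3 \<sigma>_pos R_pos by (auto simp: p cbox_Pair_eq front_def)
      then have "front \<sigma> t * \<phi> (n * x) \<le> \<sigma> * R * P"
        using P \<phi>_nonneg \<sigma>_pos R_pos by (intro mult_mono) auto
      then have "(lam - \<alpha>) * (2 * real n) * (front \<sigma> t * \<phi> (n * x)) \<le> (lam - \<alpha>) * (2 * real n) * (\<sigma> * R * P)"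
        using \<alpha>_less by (intro mult_left_mono) auto
      then have "Sx n p \<le> lam + C * n"
        using smoothed_x_upper[of \<sigma> \<alpha> lam "real n" x t] \<sigma>_pos \<alpha>_less n by (simp add: p C_def algebra_simps)
      then have "\<tau> (Sx n p) \<le> \<tau> (lam + C * n)"
        using Sx_lower[OF that, of p] \<alpha>_pos by (intro \<tau>_mono) auto
      then have "\<bar>max (\<tau> (Sx n p) - \<tau> lam) 0\<bar> \<le> M n"
        using M_nonneg[of n] by (simp add: M_def)
      then have "\<bar>excess n p\<bar> \<le> M n * L"
        unfolding excess_def abs_mult using L M_nonneg by (intro mult_mono) auto
      then show ?thesis
        using ind by simp
    qed
  qed
  have integral_bound: "\<bar>LINT p|lborel. excess n p\<bar> \<le> M n / n * (4 * R * L)" if "n \<ge> 1" for n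
  proof -
    let ?B = "cbox (- (1 / n), - R) (1 / n, R) :: (real \<times> real) set"
    have int: "integrable lborel (\<lambda>p. M n * L * indicator ?B p)"
      by (intro integrable_mult_right integrable_real_indicator)
        (use emeasure_bounded_finite[OF bounded_cbox, of "(- (1 / n), - R)" "(1 / n, R)"] in \<open>simp_all add: less_top[symmetric]\<close>)
    have "\<bar>LINT p|lborel. excess n p\<bar> \<le> (LINT p|lborel. \<bar>excess n p\<bar>)"
      by (rule integral_abs_bound)
    also have "\<dots> \<le> (LINT p|lborel. M n * L * indicator ?B p)"
      using integrable_excess[OF that] bound[OF that] int by (intro integral_mono) auto
    also have "\<dots> = M n * L * measure lborel ?B"
      by simp
    \<comment> \<open>The width \<open>2 / n\<close> of the strip is what turns the bound into
      \<open>M n / n\<close>, the quantity that sublinearity controls.\<close>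
    also have "measure lborel ?B = 2 / n * (2 * R)"
      using R_pos by (simp add: content_Pair)
    finally show ?thesis
      by (simp add: field_simps)
  qed
  have "(\<lambda>n. M n / real n) \<longlonglongrightarrow> 0"
  proof -
    have top: "filterlim (\<lambda>n. lam + C * real n) at_top sequentially"
      using \<open>C > 0\<close>
      by (intro filterlim_tendsto_add_at_top[OF tendsto_const] filterlim_tendsto_pos_mult_at_top[OF tendsto_const]
          filterlim_real_sequentially)
    have inv: "(\<lambda>n. 1 / real n) \<longlonglongrightarrow> 0"
      by (rule lim_1_over_n)
    \<comment> \<open>With \<open>u = lam + C * n\<close>, the quotient \<open>M n / n\<close>
      equals \<open>(\<tau> u / u) * (u / n) - \<tau> lam / n\<close>, and \<open>u / n\<close>
      tends to the finite value \<open>C\<close>.\<close>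
    have "(\<lambda>n. \<tau> (lam + C * real n) / (lam + C * real n) * (lam * (1 / real n) + C) - \<tau> lam * (1 / real n))
        \<longlonglongrightarrow> 0 * (lam * 0 + C) - \<tau> lam * 0"
      by (intro tendsto_intros filterlim_compose[OF \<tau>_sublinear top] inv)
    then have "(\<lambda>n. \<tau> (lam + C * real n) / (lam + C * real n) * (lam * (1 / real n) + C) - \<tau> lam * (1 / real n)) \<longlonglongrightarrow> 0"
      by simp
    moreover have "\<forall>\<^sub>F n in sequentially. \<tau> (lam + C * real n) / (lam + C * real n) * (lam * (1 / real n) + C)
        - \<tau> lam * (1 / real n) = M n / real n"
      using eventually_gt_at_top[of 0]
    proof eventually_elim
      case (elim n)
      have nz: "lam + C * real n \<noteq> 0"
        using \<alpha>_pos \<alpha>_less \<open>C > 0\<close> by (smt (verit) mult_nonneg_nonneg of_nat_0_le_iff)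
      have "lam * (1 / real n) + C = (lam + C * real n) / real n"
        using elim by (simp add: field_simps)
      then show ?case
        using nz by (simp add: M_def diff_divide_distrib)
    qed
    ultimately show ?thesis
      by (rule Lim_transform_eventually)
  qed
  then have "(\<lambda>n. M (Suc n) / real (Suc n)) \<longlonglongrightarrow> 0"
    by (rule LIMSEQ_Suc)
  then have "(\<lambda>n. M (Suc n) / real (Suc n) * (4 * R * L)) \<longlonglongrightarrow> 0"
    by (rule tendsto_mult_left_zero)
  then show ?thesis
  proof (rule Lim_null_comparison[rotated])
    show "\<forall>\<^sub>F n in sequentially. norm (LINT p|lborel. excess (Suc n) p) \<le> M (Suc n) / real (Suc n) * (4 * R * L)"
      using integral_bound[of "Suc n" for n] by (intro always_eventually allI) (metis le_add1 plus_1_eq_Suc real_norm_def)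
  qed
qed

lemma weak_integrand_eq:
  assumes "n \<ge> 1" "\<And>x t. w x t = S n (x, t)"
  shows "weak_integrand \<tau> w \<psi> x t = truncated n (x, t) + excess n (x, t)"
proof -
  have "deriv (\<lambda>r. \<psi> (x, r)) = (\<lambda>s. \<psi>t (x, s))"
    using deriv_t DERIV_imp_deriv by blast
  then have tt: "deriv (\<lambda>s. deriv (\<lambda>r. \<psi> (x, r)) s) t = \<psi>tt (x, t)"
    using DERIV_imp_deriv[OF deriv_tt] by simp
  have "deriv (\<lambda>\<xi>. w \<xi> t) x = Sx n (x, t)"
    unfolding assms(2) by (rule DERIV_imp_deriv[OF smoothed_deriv]) (use assms(1) in simp)
  then show ?thesis
    by (simp add: truncated_plus_excess weak_integrand_def tt DERIV_imp_deriv[OF deriv_x] assms(2))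
qed

text \<open>Definitions integrate over \<open>lebesgue\<close>, the calculus above over
  \<open>lborel\<close>. The integrand is continuous, so it and its slices are Borel; for the outer
  integral, Fubini supplies measurability of the inner one.\<close>

lemma
  assumes "n \<ge> 1" "\<And>x t. w x t = S n (x, t)"
  shows integrable_weak_integrand: "integrable lebesgue (\<lambda>(x, t). weak_integrand \<tau> w \<psi> x t)"
    and integral_weak_integrand: "(LINT t|lebesgue. LINT x|lebesgue. weak_integrand \<tau> w \<psi> x t)
      = (LINT p|lborel. truncated n p) + (LINT p|lborel. excess n p)"
proof -
  define f where "f p = truncated n p + excess n p" for p
  have cont: "continuous_on UNIV f"
    unfolding f_def by (intro continuous_on_add continuous_truncated continuous_excess assms)
  have int: "integrable lborel f"
    unfolding f_def by (intro Bochner_Integration.integrable_add integrable_truncated integrable_excess assms)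
  have eq: "weak_integrand \<tau> w \<psi> x t = f (x, t)" for x t
    using weak_integrand_eq[OF assms] by (simp add: f_def)
  show "integrable lebesgue (\<lambda>(x, t). weak_integrand \<tau> w \<psi> x t)"
    using int by (simp add: eq integrable_completion borel_measurable_continuous_onI[OF cont])
  have "(LINT x|lebesgue. f (x, t)) = (LINT x|lborel. f (x, t))" for t
  proof -
    have "continuous_on UNIV (\<lambda>x. f (x, t))"
      by (rule continuous_on_compose2[OF cont]) (auto intro!: continuous_intros)
    then show ?thesis
      by (simp add: integral_completion borel_measurable_continuous_onI)
  qed
  moreover have "(\<lambda>t. LINT x|lborel. f (x, t)) \<in> borel_measurable lborel"
    using lborel_pair.integrable_snd[of "\<lambda>x t. f (x, t)"] int
    by (intro borel_measurable_integrable) (simp add: lborel_prod)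
  ultimately have "(LINT t|lebesgue. LINT x|lebesgue. f (x, t)) = (LINT p|lborel. f p)"
    using lborel_Fubini(2)[OF int] by (simp add: integral_completion)
  then show "(LINT t|lebesgue. LINT x|lebesgue. weak_integrand \<tau> w \<psi> x t)
      = (LINT p|lborel. truncated n p) + (LINT p|lborel. excess n p)"
    unfolding eq f_def
    using Bochner_Integration.integral_add[OF integrable_truncated[OF assms(1)] integrable_excess[OF assms(1)]] by simp
qed

end

section \<open>Integrability, monotonicity and weak limit for the given solution\<close>

theorem proposition2p3:
  fixes \<tau> \<tau>' \<tau>'' :: "real \<Rightarrow> real"
    and \<alpha> lam \<sigma> Y0 :: real
    and y :: "real \<Rightarrow> real \<Rightarrow> real"
  assumes "\<And>u. u > 0 \<Longrightarrow> (\<tau> has_real_derivative \<tau>' u) (at u)"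
    and "\<And>u. u > 0 \<Longrightarrow> (\<tau>' has_real_derivative \<tau>'' u) (at u)"
    and "\<And>u. u > 0 \<Longrightarrow> \<tau>' u > 0"
    and "\<And>u. u > 0 \<Longrightarrow> \<tau>'' u < 0"
    and "filterlim \<tau> at_bot (at_right 0)"
    and "filterlim (\<lambda>u::real. LBINT s=1..u. \<tau> s) at_top (at_right 0)"
    and "\<alpha> > 0" and "lam > 0" and "\<sigma> > 0" and "Y0 > 0" and "lam > \<alpha>"
    and "Y0 = (lam - \<alpha>) * \<sigma>"
    and "\<sigma> = sqrt ((\<tau> lam - \<tau> \<alpha>) / (lam - \<alpha>))"
    and "\<And>x t. t \<le> 0 \<Longrightarrow> y x t = lam * x"
    and "\<And>x t. t > 0 \<Longrightarrow> x < - \<sigma> * t \<Longrightarrow> y x t = lam * x"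
    and "\<And>x t. t > 0 \<Longrightarrow> - \<sigma> * t < x \<Longrightarrow> x < 0 \<Longrightarrow> y x t = - t * Y0 + \<alpha> * x"
    and "\<And>x t. t > 0 \<Longrightarrow> 0 < x \<Longrightarrow> x < \<sigma> * t \<Longrightarrow> y x t = t * Y0 + \<alpha> * x"
    and "\<And>x t. t > 0 \<Longrightarrow> \<sigma> * t < x \<Longrightarrow> y x t = lam * x"
    and "((\<lambda>u. \<tau> u / u) \<longlongrightarrow> 0) at_top"
  shows "slic_solution \<tau> y"
proof -
  note \<tau>' = assms(1) and \<tau>'_pos = assms(3) and \<alpha>_pos = assms(7) and \<sigma>_pos = assms(9) and \<alpha>_less = assms(11)
  have rankine_hugoniot: "(lam - \<alpha>) * \<sigma>\<^sup>2 = \<tau> lam - \<tau> \<alpha>"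
  proof -
    \<comment> \<open>Positivity of \<open>\<sigma>\<close>, itself the square root, forces a
      positive radicand, so the root may be squared.\<close>
    have "0 \<le> (\<tau> lam - \<tau> \<alpha>) / (lam - \<alpha>)"
      using assms(9,13) real_sqrt_gt_0_iff less_imp_le by metis
    then have "\<sigma>\<^sup>2 = (\<tau> lam - \<tau> \<alpha>) / (lam - \<alpha>)"
      unfolding assms(13) by (rule real_sqrt_pow2)
    then show ?thesis
      using \<alpha>_less by simp
  qed
  have y_eq: "y x t = profile \<alpha> lam \<sigma> x t" if "x \<noteq> 0" "x \<noteq> \<sigma> * t" "x \<noteq> - \<sigma> * t" for x t
  proof (cases "t \<le> 0")
    case True
    then have "profile \<alpha> lam \<sigma> x t = \<alpha> * x + (lam - \<alpha>) * x"
      using profile_eq_sgn[OF \<sigma>_pos that(1)] by (simp add: front_def sgn_mult_abs)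
    then show ?thesis
      using True assms(14) by (simp add: algebra_simps)
  next
    case False
    then have "t > 0" "0 < \<sigma> * t" "front \<sigma> t = \<sigma> * t"
      using \<sigma>_pos by (auto simp: front_def)
    moreover have "x < - \<sigma> * t \<or> (- \<sigma> * t < x \<and> x < 0) \<or> (0 < x \<and> x < \<sigma> * t) \<or> \<sigma> * t < x"
      using that by linarith
    ultimately show ?thesis
      using assms(15-18)[of t x] assms(12)
      by (elim disjE conjE) (simp_all add: profile_def algebra_simps)
  qed
  have y_eq_AE: "AE x in lebesgue. y x t = profile \<alpha> lam \<sigma> x t" for t
  proof -
    have "AE x in lborel. x \<noteq> 0 \<and> x \<noteq> \<sigma> * t \<and> x \<noteq> - \<sigma> * t"
      using AE_lborel_singleton[of 0] AE_lborel_singleton[of "\<sigma> * t"] AE_lborel_singleton[of "- \<sigma> * t"]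
      by eventually_elim simp
    then show ?thesis
      using y_eq by (auto simp: AE_completion_iff elim: eventually_mono)
  qed
  have "Linf_loc_L1_loc y"
    unfolding Linf_loc_L1_loc_def
  proof (intro conjI allI impI)
    \<comment> \<open>Joint measurability of \<open>y\<close>, whose values on the three lines are
      arbitrary, follows from that of the profile because \<open>lebesgue\<close> is
      complete.\<close>
    have "AE p in lebesgue. profile \<alpha> lam \<sigma> (fst p) (snd p) = (case p of (x, t) \<Rightarrow> y x t)"
      unfolding AE_completion_iff using AE_off_shock_lines[of \<sigma>]
      by eventually_elim (auto simp: y_eq)
    then show "(\<lambda>(x, t). y x t) \<in> borel_measurable (lebesgue :: (real \<times> real) measure)"
      by (rule borel_measurable_AE[rotated]) (intro measurable_completion, simp)
    fix K T :: "real set"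
    assume "compact K \<and> compact T"
    then obtain A B where A: "\<And>x. x \<in> K \<Longrightarrow> \<bar>x\<bar> \<le> A" and B: "\<And>t. t \<in> T \<Longrightarrow> \<bar>t\<bar> \<le> B" and K: "compact K"
      by (metis bounded_iff compact_imp_bounded real_norm_def)
    have [measurable]: "K \<in> sets borel"
      using K by (simp add: compact_imp_closed)
    \<comment> \<open>This is \<open>profile_bound\<close> evaluated on \<open>K\<close> and
      \<open>T\<close>; the absolute values allow for empty sets, for which \<open>A\<close> or
      \<open>B\<close> may be negative.\<close>
    define D where "D = lam * \<bar>A\<bar> + (lam - \<alpha>) * (4 * (\<sigma> * \<bar>B\<bar>))"
    have "D \<ge> 0"
      using \<alpha>_pos \<alpha>_less \<sigma>_pos by (simp add: D_def)
    show "\<exists>C. AE t in lebesgue. t \<in> T \<longrightarrow>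
        set_integrable lebesgue K (\<lambda>x. y x t) \<and> (LINT x:K|lebesgue. \<bar>y x t\<bar>) \<le> C"
    proof (intro exI AE_I2 impI)
      fix t assume "t \<in> T"
      define f where "f x = indicator K x * profile \<alpha> lam \<sigma> x t" for x
      have f_meas: "f \<in> borel_measurable borel"
        unfolding f_def by measurable
      have f_bound: "\<bar>f x\<bar> \<le> D * indicator (cbox (- A) A) x" for x
      proof (cases "x \<in> K")
        case True
        have "front \<sigma> t \<le> \<sigma> * \<bar>B\<bar>"
          using B[OF \<open>t \<in> T\<close>] \<sigma>_pos by (auto simp: front_def intro!: mult_left_mono)
        then have "lam * \<bar>x\<bar> + (lam - \<alpha>) * (4 * front \<sigma> t) \<le> D"
          unfolding D_def using A[OF True] \<alpha>_pos \<alpha>_less by (intro add_mono mult_left_mono) auto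
        then have "\<bar>profile \<alpha> lam \<sigma> x t\<bar> \<le> D"
          using profile_bound[of \<sigma> \<alpha> lam x t] \<sigma>_pos \<alpha>_pos \<alpha>_less by simp
        moreover have "x \<in> cbox (- A) A"
          using A[OF True] by auto
        ultimately show ?thesis
          by (simp add: f_def True)
      qed (use \<open>D \<ge> 0\<close> in \<open>simp add: f_def\<close>)
      have f_int: "integrable lborel f"
      proof (rule integrable_bounded_on_cbox[OF f_meas])
        show "\<bar>f x\<bar> \<le> D" for x
          using f_bound[of x] \<open>D \<ge> 0\<close> by (cases "x \<in> cbox (- A) A") simp_all
        show "f x = 0" if "x \<notin> cbox (- A) A" for x
          using f_bound[of x] that by simp
      qed
      have f_meas': "f \<in> borel_measurable lebesgue"
        using f_meas by (intro measurable_completion) simp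
      have ae: "AE x in lebesgue. f x = indicator K x *\<^sub>R y x t"
        using y_eq_AE[of t] by eventually_elim (simp add: f_def)
      have y_meas: "(\<lambda>x. indicator K x *\<^sub>R y x t) \<in> borel_measurable lebesgue"
        by (rule borel_measurable_AE[OF f_meas' ae])
      have "integrable lebesgue f"
        using f_int f_meas by (simp add: integrable_completion)
      then have y_int: "integrable lebesgue (\<lambda>x. indicator K x *\<^sub>R y x t)"
        by (rule integrable_cong_AE_imp[OF _ y_meas]) (use ae in eventually_elim, simp)
      have "(LINT x:K|lebesgue. \<bar>y x t\<bar>) = (LINT x|lebesgue. \<bar>indicator K x *\<^sub>R y x t\<bar>)"
        unfolding set_lebesgue_integral_def
        by (intro Bochner_Integration.integral_cong) (auto simp: abs_mult)
      also have "\<dots> = (LINT x|lebesgue. \<bar>f x\<bar>)"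
        by (rule integral_cong_AE) (use ae f_meas' y_meas in \<open>auto elim: eventually_mono\<close>)
      also have "\<dots> = (LINT x|lborel. \<bar>f x\<bar>)"
        using f_meas by (intro integral_completion) simp
      also have "\<dots> \<le> (LINT x|lborel. D * indicator (cbox (- A) A) x)"
        using f_int f_bound
        by (intro integral_mono integrable_mult_right integrable_real_indicator)
          (use emeasure_bounded_finite[OF bounded_cbox, of "- A" A] in \<open>simp_all add: less_top[symmetric]\<close>)
      finally show "set_integrable lebesgue K (\<lambda>x. y x t) \<and>
          (LINT x:K|lebesgue. \<bar>y x t\<bar>) \<le> (LINT x|lborel. D * indicator (cbox (- A) A) x)"
        using y_int by (simp add: set_integrable_def)
    qed
  qed
  \<comment> \<open>Between a front and 0 the slope is exactly \<alpha>, so the strict inequality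
    fails for \<alpha> itself; any smaller positive constant works.\<close>
  moreover have "uniformly_increasing (\<alpha> / 2) y"
    unfolding uniformly_increasing_def
  proof (intro allI bexI impI)
    fix t x1 x2 :: real
    assume *: "x1 \<notin> {0, \<sigma> * t, - \<sigma> * t} \<and> x2 \<notin> {0, \<sigma> * t, - \<sigma> * t} \<and> x1 > x2"
    then have "\<alpha> * (x1 - x2) \<le> y x1 t - y x2 t"
      using profile_increasing[of \<sigma> \<alpha> lam x2 x1 t] \<sigma>_pos \<alpha>_less by (simp add: y_eq)
    moreover have "\<alpha> / 2 * (x1 - x2) < \<alpha> * (x1 - x2)"
      using * \<alpha>_pos by (intro mult_strict_right_mono) auto
    ultimately show "\<alpha> / 2 * (x1 - x2) < y x1 t - y x2 t"
      by linarith
  next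
    show "{0, \<sigma> * t, - \<sigma> * t} \<in> null_sets lebesgue" for t :: real
      using negligible_iff_null_sets negligible_finite by blast
  qed
  moreover have "(\<forall>n\<ge>1. integrable (lebesgue :: (real \<times> real) measure)
        (\<lambda>(x, t). weak_integrand \<tau> (mollify \<phi> y n) \<psi> x t)) \<and>
      (\<lambda>n. LINT t|lebesgue. LINT x|lebesgue. weak_integrand \<tau> (mollify \<phi> y n) \<psi> x t) \<longlonglongrightarrow> 0"
    if \<phi>: "symmetric_mollifier \<phi>" and \<psi>: "test_function \<psi>" for \<phi> \<psi>
  proof -
    obtain \<Phi> \<Psi> where "mollifier_primitives \<phi> \<Phi> \<Psi>"
      using symmetric_mollifier_imp_primitives[OF \<phi>] .
    then interpret mollifier_primitives \<phi> \<Phi> \<Psi> .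
    obtain \<psi>x \<psi>t \<psi>tt R where "space_time_bump \<psi> \<psi>x \<psi>t \<psi>tt R"
      using test_function_imp_space_time_bump[OF \<psi>] .
    then interpret space_time_bump \<psi> \<psi>x \<psi>t \<psi>tt R .
    interpret mollified_shock \<phi> \<Phi> \<Psi> \<psi> \<psi>x \<psi>t \<psi>tt R \<tau> \<alpha> lam \<sigma>
    proof
      show "continuous_on {0<..} \<tau>"
        using \<tau>' by (intro continuous_at_imp_continuous_on ballI DERIV_isCont) auto
      show "\<tau> u \<le> \<tau> v" if "0 < u" "u \<le> v" for u v
      proof (rule DERIV_nonneg_imp_nondecreasing[OF that(2)])
        show "\<exists>d. (\<tau> has_real_derivative d) (at s) \<and> 0 \<le> d" if "u \<le> s" "s \<le> v" for s
          using \<tau>'[of s] \<tau>'_pos[of s] that \<open>0 < u\<close> by (intro exI[of _ "\<tau>' s"]) auto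
      qed
    qed (use assms(19) \<alpha>_pos \<alpha>_less \<sigma>_pos rankine_hugoniot in auto)
    have S: "mollify \<phi> y n x t = S n (x, t)" if "n \<ge> 1" for n x t
      using mollify_cong_AE[where w = "profile \<alpha> lam \<sigma>" and y = y and t = t] y_eq_AE mollify_profile[OF that] by simp
    \<comment> \<open>The index is shifted because the kernel degenerates at \<open>n = 0\<close>
      and the closed form of the mollification holds from 1 on; the shift does not change the
      limit.\<close>
    have "(\<lambda>n. (LINT p|lborel. truncated (Suc n) p) + (LINT p|lborel. excess (Suc n) p)) \<longlonglongrightarrow> 0 + 0"
      by (intro tendsto_add truncated_limit excess_limit)
    then have "(\<lambda>n. LINT t|lebesgue. LINT x|lebesgue. weak_integrand \<tau> (mollify \<phi> y (Suc n)) \<psi> x t) \<longlonglongrightarrow> 0"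
      by (simp add: integral_weak_integrand[OF _ S])
    then show ?thesis
      using integrable_weak_integrand[OF _ S]
        filterlim_sequentially_Suc[of "\<lambda>n. LINT t|lebesgue. LINT x|lebesgue. weak_integrand \<tau> (mollify \<phi> y n) \<psi> x t"]
      by blast
  qed
  ultimately show ?thesis
    unfolding slic_solution_def using \<alpha>_pos by (metis half_gt_zero)
qed

end
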